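(* Let $(W,S)$ be a Coxeter system, let $(X,\mathrm{ht})$ be a quasiparabolic $W$-set, and let $T(X)$ be the free $\mathbb Z[q]$-module with basis $T(x)$, $x\in X$. Put $\epsilon_+:=q$ and $\epsilon_-:=-1$. For $s\in S$ and each sign $\pm$, define the endomorphism $T_\pm(s)$ of $T(X)$ by $$T_\pm(s)T(x)=\begin{cases}T(sx)&\mathrm{ht}(sx)>\mathrm{ht}(x)\\ \epsilon_\pm T(x)&\mathrm{ht}(sx)=\mathrm{ht}(x)\ (\text{which implies } sx=x)\\ (q-1)T(x)+qT(sx)&\mathrm{ht}(sx)<\mathrm{ht}(x).\end{cases}$$ Then the map $T(s)\mapsto T_+(s)$ (respectively $T(s)\mapsto T_-(s)$), $s\in S$, affords $T(X)$ the structure of an $H_W(q)$-module (denoted $H_X^+(q)$, respectively $H_X^-(q)$).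
   Context: Coxeter systems $(W,S)$ have finite rank; $R(W)$ is the set of reflections, i.e. conjugates in $W$ of elements of $S$. A scaled $W$-set is a pair $(X,\mathrm{ht})$ with $X$ a (left) $W$-set and $\mathrm{ht}:X\to\mathbb Z$ a function with $|\mathrm{ht}(sx)-\mathrm{ht}(x)|\le 1$ for all $s\in S$, $x\in X$. A quasiparabolic $W$-set is a scaled $W$-set such that (QP1) for all $r\in R(W)$, $x\in X$, if $\mathrm{ht}(rx)=\mathrm{ht}(x)$ then $rx=x$; and (QP2) for all $r\in R(W)$, $x\in X$, $s\in S$, if $\mathrm{ht}(rx)>\mathrm{ht}(x)$ and $\mathrm{ht}(srx)<\mathrm{ht}(sx)$, then $rx=sx$. The Hecke algebra $H_W(q)$ is the $\mathbb Z[q]$-algebra with generators $T(s)$, $s\in S$, subject to the braid relations $T(s)T(t)T(s)\cdots=T(t)T(s)T(t)\cdots$ ($m(s,t)$ factors on each side, for $s\ne t$ with $m(s,t)<\infty$, where $m(s,t)$ is the order of $st$) and the quadratic relations $(T(s)-q)(T(s)+1)=0$. *)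

theory Defs
  imports
    "HOL-Algebra.Group_Action"
    "HOL-Algebra.Generated_Groups"
    "HOL-Algebra.Multiplicative_Group"
    "HOL-Algebra.QuotRing"
    "HOL-Algebra.Module"
    "HOL-Computational_Algebra.Polynomial"
    "HOL-Library.Poly_Mapping"
begin

section \<open>Coxeter systems\<close>

text \<open>
  The words over \<open>S\<close> modulo the relations \<open>(s t)^m(s,t) = 1\<close>, where \<open>m(s,t)\<close> is the order of
  \<open>s t\<close>. Since \<open>group.ord\<close> is \<open>0\<close> on elements of infinite order, the relator is then the empty
  word and imposes nothing. For \<open>s = t\<close> the relator is \<open>s s\<close>; every letter is thus its own
  inverse, so words in the letters of \<open>S\<close> alone suffice to describe the group presented by
  these relations, and formal inverses are not needed.
\<close>

inductive coxeter_cong :: "('w, 'b) monoid_scheme \<Rightarrow> 'w set \<Rightarrow> 'w list \<Rightarrow> 'w list \<Rightarrow> bool"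
  for W (structure) and S
where
  relator: "\<lbrakk>s \<in> S; t \<in> S; u \<in> lists S; v \<in> lists S\<rbrakk> \<Longrightarrow>
    coxeter_cong W S (u @ concat (replicate (group.ord W (s \<otimes> t)) [s, t]) @ v) (u @ v)"
| refl: "u \<in> lists S \<Longrightarrow> coxeter_cong W S u u"
| sym: "coxeter_cong W S u v \<Longrightarrow> coxeter_cong W S v u"
| trans: "\<lbrakk>coxeter_cong W S u v; coxeter_cong W S v w\<rbrakk> \<Longrightarrow> coxeter_cong W S u w"

definition word_value :: "('w, 'b) monoid_scheme \<Rightarrow> 'w list \<Rightarrow> 'w" where
  "word_value W u = foldr (monoid.mult W) u (monoid.one W)"

text \<open>
  Generators are involutions, generate \<open>W\<close>, and all relations between them are consequences of
  the relations \<open>(s t)^m(s,t) = 1\<close>, i.e. \<open>W\<close> is presented by these.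
\<close>

locale coxeter_system = group W for W (structure) +
  fixes S
  assumes finite_S: "finite S"
    and S_carrier: "S \<subseteq> carrier W"
    and S_order: "s \<in> S \<Longrightarrow> ord s = 2"
    and S_generates: "generate W S = carrier W"
    and presentation: "\<lbrakk>u \<in> lists S; v \<in> lists S; word_value W u = word_value W v\<rbrakk> \<Longrightarrow>
      coxeter_cong W S u v"

definition reflections :: "('w, 'b) monoid_scheme \<Rightarrow> 'w set \<Rightarrow> 'w set" where
  "reflections W S = {g \<otimes>\<^bsub>W\<^esub> s \<otimes>\<^bsub>W\<^esub> inv\<^bsub>W\<^esub> g | g s. g \<in> carrier W \<and> s \<in> S}"


section \<open>Quasiparabolic sets\<close>

text \<open>The action is \<open>\<phi>\<close>: the element \<open>w x\<close> of \<open>X\<close> is \<open>\<phi> w x\<close>.\<close>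

locale scaled_W_set = coxeter_system W S + group_action W X \<phi>
  for W (structure) and S and X and \<phi> +
  fixes ht :: "'x \<Rightarrow> int"
  assumes ht_scaled: "\<lbrakk>s \<in> S; x \<in> X\<rbrakk> \<Longrightarrow> \<bar>ht (\<phi> s x) - ht x\<bar> \<le> 1"

locale quasiparabolic_W_set = scaled_W_set +
  assumes QP1: "\<lbrakk>r \<in> reflections W S; x \<in> X; ht (\<phi> r x) = ht x\<rbrakk> \<Longrightarrow> \<phi> r x = x"
    and QP2: "\<lbrakk>r \<in> reflections W S; x \<in> X; s \<in> S; ht (\<phi> r x) > ht x;
      ht (\<phi> s (\<phi> r x)) < ht (\<phi> s x)\<rbrakk> \<Longrightarrow> \<phi> r x = \<phi> s x"


section \<open>The Hecke algebra\<close>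

text \<open>
  \<open>\<int>[q]\<close> is the type \<open>int poly\<close>. With lists regarded as the free monoid under concatenation,
  the convolution product of \<open>Poly_Mapping\<close> makes \<open>'w list \<Rightarrow>\<^sub>0 int poly\<close> the free associative
  \<open>\<int>[q]\<close>-algebra on the letters of type \<open>'w\<close>.
\<close>

instantiation list :: (type) monoid_add
begin

definition zero_list :: "'a list" where "zero_list = []"

definition plus_list :: "'a list \<Rightarrow> 'a list \<Rightarrow> 'a list" where "plus_list = append"

instance by standard (simp_all add: zero_list_def plus_list_def)

end

definition q_var :: "int poly" where "q_var = [:0, 1:]"

definition free_algebra :: "'w set \<Rightarrow> ('w list \<Rightarrow>\<^sub>0 int poly) ring" where
  "free_algebra S =
    \<lparr>carrier = {f. Poly_Mapping.keys f \<subseteq> lists S}, monoid.mult = (*), one = 1, zero = 0, add = (+)\<rparr>"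

definition free_gen :: "'w \<Rightarrow> 'w list \<Rightarrow>\<^sub>0 int poly" where
  "free_gen s = Poly_Mapping.single [s] 1"

definition free_scalar :: "int poly \<Rightarrow> 'w list \<Rightarrow>\<^sub>0 int poly" where
  "free_scalar c = Poly_Mapping.single [] c"

text \<open>\<open>alternating n s t\<close> is the list \<open>[s, t, s, \<dots>]\<close> with \<open>n\<close> entries.\<close>

fun alternating :: "nat \<Rightarrow> 'w \<Rightarrow> 'w \<Rightarrow> 'w list" where
  "alternating 0 s t = []"
| "alternating (Suc n) s t = s # alternating n t s"

definition braid_relations :: "('w, 'b) monoid_scheme \<Rightarrow> 'w set \<Rightarrow> ('w list \<Rightarrow>\<^sub>0 int poly) set" where
  "braid_relations W S =
    {prod_list (map free_gen (alternating m s t)) - prod_list (map free_gen (alternating m t s))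
      | m s t. s \<in> S \<and> t \<in> S \<and> s \<noteq> t \<and> m = group.ord W (s \<otimes>\<^bsub>W\<^esub> t) \<and> m > 0}"

definition quadratic_relations :: "'w set \<Rightarrow> ('w list \<Rightarrow>\<^sub>0 int poly) set" where
  "quadratic_relations S = {(free_gen s - free_scalar q_var) * (free_gen s + 1) | s. s \<in> S}"

definition hecke_ideal :: "('w, 'b) monoid_scheme \<Rightarrow> 'w set \<Rightarrow> ('w list \<Rightarrow>\<^sub>0 int poly) set" where
  "hecke_ideal W S = Idl\<^bsub>free_algebra S\<^esub> (braid_relations W S \<union> quadratic_relations S)"

definition hecke_algebra ::
    "('w, 'b) monoid_scheme \<Rightarrow> 'w set \<Rightarrow> ('w list \<Rightarrow>\<^sub>0 int poly) set ring" where
  "hecke_algebra W S = free_algebra S Quot hecke_ideal W S"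

definition hecke_gen ::
    "('w, 'b) monoid_scheme \<Rightarrow> 'w set \<Rightarrow> 'w \<Rightarrow> ('w list \<Rightarrow>\<^sub>0 int poly) set" where
  "hecke_gen W S s = hecke_ideal W S +>\<^bsub>free_algebra S\<^esub> free_gen s"

text \<open>The structure map of the \<open>\<int>[q]\<close>-algebra.\<close>

definition hecke_scalar ::
    "('w, 'b) monoid_scheme \<Rightarrow> 'w set \<Rightarrow> int poly \<Rightarrow> ('w list \<Rightarrow>\<^sub>0 int poly) set" where
  "hecke_scalar W S c = hecke_ideal W S +>\<^bsub>free_algebra S\<^esub> free_scalar c"


section \<open>Modules over the Hecke algebra\<close>

text \<open>The axioms of the locale \<open>module\<close>, without commutativity of the ring.\<close>

locale left_module = R?: ring R + M?: abelian_group M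
  for R :: "('r, 'b) ring_scheme" (structure) and M :: "('r, 'm, 'c) module_scheme" (structure) +
  assumes smult_closed:
      "\<lbrakk>a \<in> carrier R; x \<in> carrier M\<rbrakk> \<Longrightarrow> a \<odot>\<^bsub>M\<^esub> x \<in> carrier M"
    and smult_l_distr:
      "\<lbrakk>a \<in> carrier R; b \<in> carrier R; x \<in> carrier M\<rbrakk> \<Longrightarrow>
        (a \<oplus>\<^bsub>R\<^esub> b) \<odot>\<^bsub>M\<^esub> x = a \<odot>\<^bsub>M\<^esub> x \<oplus>\<^bsub>M\<^esub> b \<odot>\<^bsub>M\<^esub> x"
    and smult_r_distr:
      "\<lbrakk>a \<in> carrier R; x \<in> carrier M; y \<in> carrier M\<rbrakk> \<Longrightarrow>
        a \<odot>\<^bsub>M\<^esub> (x \<oplus>\<^bsub>M\<^esub> y) = a \<odot>\<^bsub>M\<^esub> x \<oplus>\<^bsub>M\<^esub> a \<odot>\<^bsub>M\<^esub> y"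
    and smult_assoc:
      "\<lbrakk>a \<in> carrier R; b \<in> carrier R; x \<in> carrier M\<rbrakk> \<Longrightarrow>
        (a \<otimes>\<^bsub>R\<^esub> b) \<odot>\<^bsub>M\<^esub> x = a \<odot>\<^bsub>M\<^esub> (b \<odot>\<^bsub>M\<^esub> x)"
    and smult_one: "x \<in> carrier M \<Longrightarrow> \<one>\<^bsub>R\<^esub> \<odot>\<^bsub>M\<^esub> x = x"

text \<open>
  \<open>with_action M act\<close> is the additive group of \<open>M\<close> with scalar multiplication \<open>act\<close>, possibly
  over a different ring.
\<close>

definition with_action :: "('r, 'm) module \<Rightarrow> ('h \<Rightarrow> 'm \<Rightarrow> 'm) \<Rightarrow> ('h, 'm) module" where
  "with_action M act =
    \<lparr>carrier = carrier M, monoid.mult = monoid.mult M, one = monoid.one M,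
     zero = ring.zero M, add = ring.add M, module.smult = act\<rparr>"

text \<open>
  An \<open>H_W(q)\<close>-module structure on a \<open>\<int>[q]\<close>-module \<open>M\<close>; the scalars \<open>\<int>[q]\<close> of the algebra
  act through the given \<open>\<int>[q]\<close>-module structure.
\<close>

definition hecke_module_structure ::
    "('w, 'b) monoid_scheme \<Rightarrow> 'w set \<Rightarrow> (int poly, 'm) module \<Rightarrow>
      (('w list \<Rightarrow>\<^sub>0 int poly) set \<Rightarrow> 'm \<Rightarrow> 'm) \<Rightarrow> bool" where
  "hecke_module_structure W S M act \<longleftrightarrow>
    left_module (hecke_algebra W S) (with_action M act) \<and>
    (\<forall>c. \<forall>v \<in> carrier M. act (hecke_scalar W S c) v = c \<odot>\<^bsub>M\<^esub> v)"


section \<open>The module \<open>T(X)\<close> and the operators \<open>T\<^sub>\<plusminus>(s)\<close>\<close>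

definition T_basis :: "'x \<Rightarrow> 'x \<Rightarrow>\<^sub>0 int poly" where
  "T_basis x = Poly_Mapping.single x 1"

definition T_scale :: "int poly \<Rightarrow> ('x \<Rightarrow>\<^sub>0 int poly) \<Rightarrow> ('x \<Rightarrow>\<^sub>0 int poly)" where
  "T_scale c v = Poly_Mapping.map ((*) c) v"

text \<open>
  The free \<open>\<int>[q]\<close>-module on the subset \<open>X\<close> of a type. The fields \<open>mult\<close> and \<open>one\<close> of the record
  type are irrelevant for modules.
\<close>

definition T_module :: "'x set \<Rightarrow> (int poly, 'x \<Rightarrow>\<^sub>0 int poly) module" where
  "T_module X =
    \<lparr>carrier = {v. Poly_Mapping.keys v \<subseteq> X}, monoid.mult = undefined, monoid.one = undefined,
     zero = 0, add = (+), module.smult = T_scale\<rparr>"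

definition T_op_basis ::
    "('w \<Rightarrow> 'x \<Rightarrow> 'x) \<Rightarrow> ('x \<Rightarrow> int) \<Rightarrow> int poly \<Rightarrow> 'w \<Rightarrow> 'x \<Rightarrow> 'x \<Rightarrow>\<^sub>0 int poly" where
  "T_op_basis \<phi> ht \<epsilon> s x =
    (if ht (\<phi> s x) > ht x then T_basis (\<phi> s x)
     else if ht (\<phi> s x) = ht x then T_scale \<epsilon> (T_basis x)
     else T_scale (q_var - 1) (T_basis x) + T_scale q_var (T_basis (\<phi> s x)))"

text \<open>The linear extension to all of \<open>T(X)\<close>.\<close>

definition T_op ::
    "('w \<Rightarrow> 'x \<Rightarrow> 'x) \<Rightarrow> ('x \<Rightarrow> int) \<Rightarrow> int poly \<Rightarrow> 'w \<Rightarrow> ('x \<Rightarrow>\<^sub>0 int poly) \<Rightarrow> ('x \<Rightarrow>\<^sub>0 int poly)"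
  where "T_op \<phi> ht \<epsilon> s v =
    (\<Sum>x \<in> Poly_Mapping.keys v. T_scale (Poly_Mapping.lookup v x) (T_op_basis \<phi> ht \<epsilon> s x))"

definition \<epsilon>_plus :: "int poly" where "\<epsilon>_plus = q_var"

definition \<epsilon>_minus :: "int poly" where "\<epsilon>_minus = -1"

end

theory Submission
  imports Defs
begin

text \<open>
  The quadratic relations can be read off on basis elements, so the point is the braid relation for
  \<open>s\<close>, \<open>t\<close> with \<open>m = m(s,t)\<close> finite. The vectors on which the two alternating products of
  length \<open>n\<close> agree are stable under \<open>T(s)\<close> and \<open>T(t)\<close>, as a consequence of the quadratic relations
  alone. Since \<open>q\<close> is not a zero divisor, they contain all \<open>T(y)\<close> for \<open>y\<close> in the \<open>\<langle>s,t\<rangle>\<close>-orbit of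
  \<open>x\<close> as soon as they contain \<open>T(x)\<close>, and agreement in length \<open>n\<close> implies agreement in all multiples
  of \<open>n\<close>. It is thus enough to find, in each orbit, one \<open>x\<close> for which both products of some length
  \<open>n\<close> dividing \<open>m\<close> agree on \<open>T(x)\<close>. Take \<open>x\<close> of minimal height. By (QP1) and (QP2) there are two
  possibilities. Either the two paths going up from \<open>x\<close> meet for the first time at their common
  top, after \<open>n\<close> steps each, and both products map \<open>T(x)\<close> to the basis element of the top; or one of
  \<open>s\<close>, \<open>t\<close> fixes \<open>x\<close> and the orbit is a single path of \<open>n\<close> points going up from \<open>x\<close>, with a loop at
  each end, and both products give \<open>\<epsilon>\<close> times the basis element of the top.
\<close>

section \<open>Linear maps on free \<open>\<int>[q]\<close>-modules\<close>

lemma poly_mapping_eq_sum_single: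
  "f = (\<Sum>k\<in>Poly_Mapping.keys f. Poly_Mapping.single k (Poly_Mapping.lookup f k))"
proof (rule poly_mapping_eqI)
  fix x
  have "Poly_Mapping.lookup (\<Sum>k\<in>Poly_Mapping.keys f. Poly_Mapping.single k (Poly_Mapping.lookup f k)) x
      = (\<Sum>k\<in>Poly_Mapping.keys f. if k = x then Poly_Mapping.lookup f k else 0)"
    by (simp add: lookup_sum lookup_single when_def)
  also have "\<dots> = Poly_Mapping.lookup f x"
    by (auto simp: sum.delta' in_keys_iff)
  finally show "Poly_Mapping.lookup f x = Poly_Mapping.lookup
      (\<Sum>k\<in>Poly_Mapping.keys f. Poly_Mapping.single k (Poly_Mapping.lookup f k)) x" ..
qed

lemma poly_mapping_induct [case_names zero single add]:
  fixes P :: "('a \<Rightarrow>\<^sub>0 'b::comm_monoid_add) \<Rightarrow> bool"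
  assumes "P 0" and "\<And>k c. P (Poly_Mapping.single k c)"
    and "\<And>f g. P f \<Longrightarrow> P g \<Longrightarrow> P (f + g)"
  shows "P f"
proof -
  have "P (\<Sum>k\<in>A. Poly_Mapping.single k (Poly_Mapping.lookup f k))" if "finite A" for A
    using that by induction (auto intro: assms)
  then show ?thesis
    by (subst poly_mapping_eq_sum_single) simp
qed

lemma lookup_T_scale [simp]: "Poly_Mapping.lookup (T_scale c v) x = c * Poly_Mapping.lookup v x"
  by (simp add: T_scale_def Poly_Mapping.map.rep_eq when_def)

lemma T_scale_0_left [simp]: "T_scale 0 v = 0"
  and T_scale_0_right [simp]: "T_scale c 0 = 0"
  and T_scale_1 [simp]: "T_scale 1 v = v"
  and T_scale_T_scale [simp]: "T_scale c (T_scale d v) = T_scale (c * d) v"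
  and T_scale_add: "T_scale c (u + v) = T_scale c u + T_scale c v"
  and T_scale_add_left: "T_scale (c + d) v = T_scale c v + T_scale d v"
  and T_scale_diff_left: "T_scale (c - d) v = T_scale c v - T_scale d v"
  by (rule poly_mapping_eqI; simp add: lookup_add lookup_minus algebra_simps)+

lemma T_scale_cancel: "T_scale c u = T_scale c v \<longleftrightarrow> c = 0 \<or> u = v"
  by (auto simp: poly_mapping_eq_iff fun_eq_iff)

lemma T_scale_sum: "T_scale c (sum f A) = (\<Sum>a\<in>A. T_scale c (f a))"
  by (induction A rule: infinite_finite_induct) (auto simp: T_scale_add)

lemma T_scale_single: "T_scale c (Poly_Mapping.single x d) = Poly_Mapping.single x (c * d)"
  by (rule poly_mapping_eqI) (simp add: lookup_single when_def)

lemma keys_T_scale: "Poly_Mapping.keys (T_scale c v) \<subseteq> Poly_Mapping.keys v"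
  by (auto simp: in_keys_iff)

locale T_linear =
  fixes A :: "('x \<Rightarrow>\<^sub>0 int poly) \<Rightarrow> ('y \<Rightarrow>\<^sub>0 int poly)"
  assumes add: "A (u + v) = A u + A v"
    and scale: "A (T_scale c v) = T_scale c (A v)"
begin

lemma zero: "A 0 = 0"
  using scale[of 0 0] by simp

lemma diff: "A (u - v) = A u - A v"
  using add[of "u - v" v] by (simp add: algebra_simps)

lemma sum: "A (sum f I) = (\<Sum>i\<in>I. A (f i))"
  by (induction I rule: infinite_finite_induct) (auto simp: add zero)

end

lemma T_linear_foldr:
  assumes "\<And>s. T_linear (op s)"
  shows "T_linear (foldr op w)"
proof (induction w)
  case (Cons s w)
  interpret A: T_linear "op s" by (rule assms)
  interpret B: T_linear "foldr op w" by (rule Cons.IH)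
  show ?case by unfold_locales (simp_all add: A.add A.scale B.add B.scale)
qed (unfold_locales; simp)

text \<open>Serves two bases: the points of \<open>X\<close>, to extend the operators linearly, and
  the words over \<open>S\<close>, to let the free algebra act (see
  \<open>free_act\<close>).\<close>

definition T_extend ::
    "('a \<Rightarrow> 'x \<Rightarrow>\<^sub>0 int poly) \<Rightarrow> ('a \<Rightarrow>\<^sub>0 int poly) \<Rightarrow> 'x \<Rightarrow>\<^sub>0 int poly" where
  "T_extend F f = (\<Sum>a\<in>Poly_Mapping.keys f. T_scale (Poly_Mapping.lookup f a) (F a))"

lemma T_op_eq_T_extend: "T_op \<phi> ht \<epsilon> s = T_extend (T_op_basis \<phi> ht \<epsilon> s)"
  by (simp add: fun_eq_iff T_op_def T_extend_def)

text \<open>A common finite index set allows sums over different supports to be compared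
  termwise.\<close>

lemma T_extend_superset:
  assumes "finite A" "Poly_Mapping.keys f \<subseteq> A"
  shows "T_extend F f = (\<Sum>a\<in>A. T_scale (Poly_Mapping.lookup f a) (F a))"
  unfolding T_extend_def
  by (rule sum.mono_neutral_left) (use assms in \<open>auto simp: in_keys_iff\<close>)

lemma T_extend_single [simp]: "T_extend F (Poly_Mapping.single a c) = T_scale c (F a)"
  by (simp add: T_extend_superset[of "{a}"])

lemma T_linear_T_extend: "T_linear (T_extend F)"
proof
  fix u v :: "'a \<Rightarrow>\<^sub>0 int poly" and c
  let ?K = "Poly_Mapping.keys u \<union> Poly_Mapping.keys v"
  show "T_extend F (u + v) = T_extend F u + T_extend F v"
    using Poly_Mapping.keys_add[of u v]
    by (simp add: T_extend_superset[of ?K] lookup_add T_scale_add_left sum.distrib)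
  show "T_extend F (T_scale c v) = T_scale c (T_extend F v)"
    using keys_T_scale[of c v]
    by (simp add: T_extend_superset[of "Poly_Mapping.keys v"] T_scale_sum)
qed

lemma keys_T_extend:
  assumes "\<And>a. a \<in> Poly_Mapping.keys f \<Longrightarrow> Poly_Mapping.keys (F a) \<subseteq> X"
  shows "Poly_Mapping.keys (T_extend F f) \<subseteq> X"
proof -
  have "Poly_Mapping.keys (T_extend F f)
      \<subseteq> (\<Union>a\<in>Poly_Mapping.keys f. Poly_Mapping.keys (T_scale (Poly_Mapping.lookup f a) (F a)))"
    unfolding T_extend_def by (rule Poly_Mapping.keys_sum)
  also have "\<dots> \<subseteq> X"
    using assms keys_T_scale by fast
  finally show ?thesis .
qed

text \<open>Agreement is asked for only on the support of the one vector \<open>v\<close>, since the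
  relations between the operators are established on vectors supported in \<open>X\<close>.\<close>

lemma T_linear_eqI:
  assumes "T_linear A" "T_linear B" "\<And>x. x \<in> Poly_Mapping.keys v \<Longrightarrow> A (T_basis x) = B (T_basis x)"
  shows "A v = B v"
proof -
  interpret A: T_linear A by fact
  interpret B: T_linear B by fact
  have v: "v = (\<Sum>x\<in>Poly_Mapping.keys v. T_scale (Poly_Mapping.lookup v x) (T_basis x))"
    using poly_mapping_eq_sum_single[of v] by (simp add: T_basis_def T_scale_single)
  show ?thesis
    by (subst (1 2) v) (simp add: A.sum B.sum A.scale B.scale assms(3))
qed


section \<open>Braid relations for operators with quadratic relations\<close>

lemma alternating_Suc_snoc:
  "alternating (Suc n) s t = alternating n s t @ [if even n then s else t]"
  by (induction n arbitrary: s t) auto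

lemma rev_alternating:
  "rev (alternating n s t) = (if even n then alternating n t s else alternating n s t)"
proof (induction n arbitrary: s t)
  case (Suc n)
  show ?case
    by (subst alternating.simps) (use Suc in \<open>auto simp: alternating_Suc_snoc simp del: alternating.simps\<close>)
qed simp

lemma alternating_add:
  "alternating (m + n) s t
    = alternating m s t @ (if even m then alternating n s t else alternating n t s)"
  by (induction m arbitrary: s t) auto

lemma alternating_subset: "set (alternating n s t) \<subseteq> {s, t}"
  by (induction n arbitrary: s t) auto

definition braid_kernel ::
    "('w \<Rightarrow> 'v \<Rightarrow> 'v) \<Rightarrow> 'w \<Rightarrow> 'w \<Rightarrow> nat \<Rightarrow> 'v set" where
  "braid_kernel op s t n = {v. foldr op (alternating n s t) v = foldr op (alternating n t s) v}"

lemma braid_kernel_commute: "braid_kernel op s t = braid_kernel op t s"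
  by (auto simp: braid_kernel_def fun_eq_iff)

text \<open>Reversal permutes the two alternating words of length \<open>n\<close>, so reading both
  from the other end gives the same set. With \<open>fold\<close> the first letter acts first, as on
  a walk starting at a point.\<close>

lemma braid_kernel_iff_fold:
  "v \<in> braid_kernel op s t n \<longleftrightarrow> fold op (alternating n s t) v = fold op (alternating n t s) v"
  by (auto simp: braid_kernel_def foldr_conv_fold rev_alternating)

text \<open>\<open>C\<close> is to become the set of vectors supported in \<open>X\<close>: off
  \<open>X\<close> the action, and with it the quadratic relation, is not controlled.\<close>

locale quadratic_operators =
  fixes op :: "'w \<Rightarrow> ('x \<Rightarrow>\<^sub>0 int poly) \<Rightarrow> ('x \<Rightarrow>\<^sub>0 int poly)"
    and s t :: 'w and C :: "('x \<Rightarrow>\<^sub>0 int poly) set"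
  assumes linear: "T_linear (op r)"
    and closed: "\<lbrakk>r \<in> {s, t}; v \<in> C\<rbrakk> \<Longrightarrow> op r v \<in> C"
    and quadratic: "\<lbrakk>r \<in> {s, t}; v \<in> C\<rbrakk> \<Longrightarrow>
      op r (op r v) = T_scale (q_var - 1) (op r v) + T_scale q_var v"
begin

lemma quadratic_operators_swap: "quadratic_operators op t s C"
  by unfold_locales (use linear[unfolded T_linear_def] closed quadratic in auto)

lemma foldr_closed: "set w \<subseteq> {s, t} \<Longrightarrow> v \<in> C \<Longrightarrow> foldr op w v \<in> C"
  by (induction w) (auto intro!: closed)

lemma foldr_alternating_closed:
  assumes "v \<in> C"
  shows "foldr op (alternating n s t) v \<in> C" "foldr op (alternating n t s) v \<in> C"
  using assms alternating_subset[of n s t] alternating_subset[of n t s]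
  by (auto intro!: foldr_closed)

text \<open>
  Let \<open>u\<close> be the common value of both words of length \<open>n\<close> on \<open>v\<close>. Applied to \<open>op l v\<close>, where
  \<open>l\<close> is the last letter of one of them, each word becomes \<open>(q - 1) u + q w v\<close>, with the same
  word \<open>w\<close> of length \<open>n - 1\<close>: the word ending in \<open>l\<close> by the quadratic relation at its end, the
  other one by the quadratic relation at its beginning.
\<close>

lemma braid_kernel_last:
  assumes v: "v \<in> C" "v \<in> braid_kernel op s t (Suc p)"
  defines "l \<equiv> if even (Suc p) then s else t"
  shows "op l v \<in> braid_kernel op s t (Suc p)"
proof -
  define u where "u = foldr op (alternating (Suc p) s t) v"
  have u': "u = foldr op (alternating (Suc p) t s) v"
    using v by (simp add: u_def braid_kernel_def)
  define w where "w = foldr op (alternating p t s) v"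
  have l: "l \<in> {s, t}" by (simp add: l_def)
  have E: "alternating (Suc p) t s = alternating p t s @ [l]"
    by (simp only: alternating_Suc_snoc) (simp add: l_def)
  have F: "alternating (Suc p) s t @ [l] = s # alternating (Suc p) t s"
    using alternating_Suc_snoc[of "Suc p" s t] by (simp add: l_def)
  interpret P: T_linear "foldr op (alternating p t s)"
    by (rule T_linear_foldr) (rule linear)
  have "foldr op (alternating (Suc p) t s) (op l v)
      = foldr op (alternating p t s) (T_scale (q_var - 1) (op l v) + T_scale q_var v)"
    unfolding E by (simp add: quadratic[OF l v(1)])
  also have "\<dots> = T_scale (q_var - 1) u + T_scale q_var w"
    using u' unfolding E by (simp add: P.add P.scale w_def)
  finally have 1: "foldr op (alternating (Suc p) t s) (op l v)
      = T_scale (q_var - 1) u + T_scale q_var w" .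
  have "foldr op (alternating (Suc p) s t) (op l v) = foldr op (alternating (Suc p) s t @ [l]) v"
    by (simp only: foldr_append foldr.simps comp_apply id_apply)
  also have "\<dots> = op s u"
    unfolding F u' by simp
  also have "\<dots> = op s (op s w)"
    by (simp add: u_def w_def)
  also have "\<dots> = T_scale (q_var - 1) u + T_scale q_var w"
    by (subst quadratic) (auto simp: u_def w_def foldr_alternating_closed v)
  finally show ?thesis
    using 1 by (simp add: braid_kernel_def)
qed

text \<open>\<open>braid_kernel_last\<close> treats the last letter of the word starting with
  \<open>t\<close>; exchanging \<open>s\<close> and \<open>t\<close> treats the other
  letter.\<close>

lemma braid_kernel_closed:
  assumes "v \<in> C" "v \<in> braid_kernel op s t n" "r \<in> {s, t}"
  shows "op r v \<in> braid_kernel op s t n"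
proof (cases n)
  case 0
  then show ?thesis by (simp add: braid_kernel_def)
next
  case (Suc p)
  interpret swap: quadratic_operators op t s C by (rule quadratic_operators_swap)
  show ?thesis
    using braid_kernel_last[of v p] swap.braid_kernel_last[of v p] assms Suc
    by (auto simp: braid_kernel_commute[of op t s] split: if_splits)
qed

lemma braid_kernel_foldr:
  "set w \<subseteq> {s, t} \<Longrightarrow> v \<in> C \<Longrightarrow> v \<in> braid_kernel op s t n \<Longrightarrow> foldr op w v \<in> braid_kernel op s t n"
  by (induction w) (auto intro!: braid_kernel_closed foldr_closed)

text \<open>Split both words of length \<open>p + n\<close> into a head of length \<open>p\<close>
  and a tail of length \<open>n\<close>. Either tail has the same value on \<open>v\<close>; by
  stability this value lies in the kernel for length \<open>p\<close>, so the heads agree on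
  it.\<close>

lemma braid_kernel_add:
  assumes v: "v \<in> C" and n: "v \<in> braid_kernel op s t n" and p: "v \<in> braid_kernel op s t p"
  shows "v \<in> braid_kernel op s t (p + n)"
proof -
  have *: "foldr op (alternating n s t) v = foldr op (alternating n t s) v"
    using n by (simp add: braid_kernel_def)
  have "foldr op (alternating n t s) v \<in> braid_kernel op s t p"
    using alternating_subset[of n t s] by (intro braid_kernel_foldr v p) auto
  then show ?thesis
    by (simp add: braid_kernel_def alternating_add *)
qed

lemma braid_kernel_dvd:
  assumes "v \<in> C" "v \<in> braid_kernel op s t n" "n dvd m"
  shows "v \<in> braid_kernel op s t m"
proof -
  have "v \<in> braid_kernel op s t (k * n)" for k
  proof (induction k)
    case 0
    show ?case by (simp add: braid_kernel_def)
  next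
    case (Suc k)
    then show ?case using braid_kernel_add[of v "k * n" n] assms by simp
  qed
  then show ?thesis using assms(3) by (metis dvd_def mult.commute)
qed

text \<open>The third part holds because \<open>int poly\<close> has no zero divisors. It is what
  allows a descent to be inverted in \<open>T_basis_braid_kernel_step\<close>.\<close>

lemma braid_kernel_submodule:
  "u \<in> braid_kernel op s t n \<Longrightarrow> v \<in> braid_kernel op s t n \<Longrightarrow> u - v \<in> braid_kernel op s t n"
  "v \<in> braid_kernel op s t n \<Longrightarrow> T_scale c v \<in> braid_kernel op s t n"
  "T_scale q_var v \<in> braid_kernel op s t n \<Longrightarrow> v \<in> braid_kernel op s t n"
proof -
  interpret L: T_linear "foldr op w" for w
    by (rule T_linear_foldr) (rule linear)
  show "u \<in> braid_kernel op s t n \<Longrightarrow> v \<in> braid_kernel op s t n \<Longrightarrow> u - v \<in> braid_kernel op s t n"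
    "v \<in> braid_kernel op s t n \<Longrightarrow> T_scale c v \<in> braid_kernel op s t n"
    "T_scale q_var v \<in> braid_kernel op s t n \<Longrightarrow> v \<in> braid_kernel op s t n"
    by (auto simp: braid_kernel_def L.diff L.scale T_scale_cancel q_var_def)
qed

end


section \<open>Walks around dihedral orbits\<close>

text \<open>
  The sequence \<open>f\<close> models the walk \<open>\<dots>, t x, x, s x, t s x, \<dots>\<close> around an orbit of a dihedral
  group. Its reflections are exactly the elements exchanging some \<open>f i\<close> and \<open>f j\<close> with \<open>i + j\<close>
  odd, in a way compatible with the walk.
\<close>

locale dihedral_walk =
  fixes f :: "int \<Rightarrow> 'x" and ht :: "'x \<Rightarrow> int" and m :: nat
  assumes m_pos: "m > 0"
    and period: "f (2 * int m) = f 0"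
    and scaled: "\<bar>ht (f (i + 1)) - ht (f i)\<bar> \<le> 1"
    and eq_if_ht_eq: "odd (i + j) \<Longrightarrow> ht (f i) = ht (f j) \<Longrightarrow> f i = f j"
    and exchange: "\<lbrakk>odd (i + j); ht (f i) < ht (f j); ht (f (j - 1)) < ht (f (i + 1))\<rbrakk> \<Longrightarrow>
      f j = f (i + 1)"
    and exchange': "\<lbrakk>odd (i + j); ht (f i) < ht (f j); ht (f (j + 1)) < ht (f (i - 1))\<rbrakk> \<Longrightarrow>
      f j = f (i - 1)"
    and step_even: "even (i + j) \<Longrightarrow> f i = f j \<Longrightarrow> f (i + 1) = f (j + 1)"
    and step_even': "even (i + j) \<Longrightarrow> f i = f j \<Longrightarrow> f (i - 1) = f (j - 1)"
    and step_odd: "odd (i + j) \<Longrightarrow> f i = f j \<Longrightarrow> f (i + 1) = f (j - 1)"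
begin

section \<open>Periodicity and symmetry of walks\<close>

lemma shift_even:
  assumes "even (i + j)" "f i = f j"
  shows "f (i + d) = f (j + d)"
proof (induction d rule: int_induct[where k = 0])
  case (step1 d)
  then show ?case using step_even[of "i + d" "j + d"] assms(1) by (simp add: add.assoc)
next
  case (step2 d)
  then show ?case using step_even'[of "i + d" "j + d"] assms(1) by (simp add: algebra_simps)
qed (use assms in simp)

text \<open>At positions of opposite parity the same letter leads in opposite directions, so a
  coincidence there makes the walk a palindrome, whereas at positions of equal parity it makes the
  walk periodic.\<close>

lemma shift_odd:
  assumes "odd (i + j)" "f i = f j"
  shows "f (i + d) = f (j - d)"
proof (induction d rule: int_induct[where k = 0])
  case (step1 d)
  then show ?case using step_odd[of "i + d" "j - d"] assms(1) by (simp add: algebra_simps)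
next
  case (step2 d)
  then show ?case using step_odd[of "j - d" "i + d"] assms(1) by (simp add: algebra_simps)
qed (use assms in simp)

lemma periodic: "f (i + 2 * int m * k) = f i"
proof (induction k rule: int_induct[where k = 0])
  case (step1 k)
  then show ?case using shift_even[OF _ period, of "i + 2 * int m * k"] by (simp add: algebra_simps)
next
  case (step2 k)
  then show ?case
    using shift_even[OF _ period, of "i + 2 * int m * (k - 1)"] by (simp add: algebra_simps)
qed simp

text \<open>Reversing the walk amounts to exchanging \<open>s\<close> and \<open>t\<close>, so what
  is proved for the path to the right transfers to the path to the left.\<close>

lemma mirror: "dihedral_walk (\<lambda>i. f (- i)) ht m"
proof
  show "f (- (2 * int m)) = f (- 0)" using periodic[of 0 "-1"] by simp
  show "\<bar>ht (f (- (i + 1))) - ht (f (- i))\<bar> \<le> 1" for i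
    using scaled[of "- i - 1"] by simp
  show "f (- i) = f (- j)" if "odd (i + j)" "ht (f (- i)) = ht (f (- j))" for i j
    using eq_if_ht_eq[of "- i" "- j"] that by simp
  show "f (- j) = f (- (i + 1))"
    if "odd (i + j)" "ht (f (- i)) < ht (f (- j))" "ht (f (- (j - 1))) < ht (f (- (i + 1)))" for i j
    using exchange'[of "- i" "- j"] that by simp
  show "f (- j) = f (- (i - 1))"
    if "odd (i + j)" "ht (f (- i)) < ht (f (- j))" "ht (f (- (j + 1))) < ht (f (- (i - 1)))" for i j
    using exchange[of "- i" "- j"] that by simp
  show "f (- (i + 1)) = f (- (j + 1))" if "even (i + j)" "f (- i) = f (- j)" for i j
    using step_even'[of "- i" "- j"] that by simp
  show "f (- (i - 1)) = f (- (j - 1))" if "even (i + j)" "f (- i) = f (- j)" for i j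
    using step_even[of "- i" "- j"] that by simp
  show "f (- (i + 1)) = f (- (j - 1))" if "odd (i + j)" "f (- i) = f (- j)" for i j
    using step_odd[of "- j" "- i"] that by (simp add: minus_diff_commute)
qed (rule m_pos)

text \<open>The locale asks for some half period, not the least one. Replacing \<open>m\<close> by
  \<open>l\<close> makes \<open>periodic\<close> available for the shorter period.\<close>

lemma change_period: "l > 0 \<Longrightarrow> f (2 * int l) = f 0 \<Longrightarrow> dihedral_walk f ht l"
  using dihedral_walk_axioms unfolding dihedral_walk_def by (elim conjE, intro conjI) assumption+

section \<open>Rising stretches and the divisors of \<open>m\<close> that they yield\<close>

lemma ex_min: "\<exists>i. \<forall>j. ht (f i) \<le> ht (f j)"
proof -
  \<comment> \<open>One full period already contains every point of the walk.\<close>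
  let ?A = "(\<lambda>i. ht (f i)) ` {0..<2 * int m}"
  have "?A \<noteq> {}" using m_pos by simp
  then have "Min ?A \<in> ?A" by (intro Min_in) auto
  then obtain i where i: "ht (f i) = Min ?A" by auto
  have "ht (f i) \<le> ht (f j)" for j
  proof -
    have "f j = f (j mod (2 * int m))"
      using periodic[of "j mod (2 * int m)" "j div (2 * int m)"] by simp
    moreover have "j mod (2 * int m) \<in> {0..<2 * int m}" using m_pos by simp
    ultimately show ?thesis unfolding i by (intro Min_le) auto
  qed
  then show ?thesis by blast
qed

text \<open>One step changes the height by at most one, so these exact heights encode
  \<open>k\<close> strict ascents in a row; they also show that the points passed are
  distinct.\<close>

definition ascending :: "nat \<Rightarrow> bool" where
  "ascending k \<longleftrightarrow> (\<forall>i\<le>k. ht (f (int i)) = ht (f 0) + int i)"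

text \<open>The walk is back at its start after \<open>2 * m\<close> steps, so it cannot rise that
  long; \<open>k\<close> is the last position up to which it rises throughout.\<close>

lemma ex_peak: "\<exists>k. ascending k \<and> ht (f (int k + 1)) \<le> ht (f (int k))"
proof -
  have "\<not> ascending (2 * m)"
    using period m_pos by (auto simp: ascending_def)
  moreover have "ascending 0" by (simp add: ascending_def)
  ultimately obtain k where k: "ascending k" "\<not> ascending (Suc k)"
    using nat_induct[of ascending "2 * m"] by blast
  then have "ht (f (int k + 1)) \<noteq> ht (f (int k)) + 1"
    by (auto simp: ascending_def le_Suc_eq algebra_simps)
  then show ?thesis using k scaled[of "int k"] by (intro exI[of _ k]) auto
qed

text \<open>The walk has period \<open>2 * l\<close>, and within one period only the start has the
  height of \<open>f 0\<close>. The remainder of \<open>2 * m\<close> modulo \<open>2 * l\<close> is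
  a position where the walk is at \<open>f 0\<close>, hence zero.\<close>

lemma dvd_of_cycle:
  assumes "l > 0" "ascending l" "dihedral_walk.ascending (\<lambda>i. f (- i)) ht l"
    "f (int l) = f (- int l)"
  shows "l dvd m"
proof -
  interpret M: dihedral_walk "\<lambda>i. f (- i)" ht m by (rule mirror)
  interpret L: dihedral_walk f ht l
    using shift_even[of "int l" "- int l" "int l"] assms by (intro change_period) simp_all
  define r where "r = (2 * int m) mod (2 * int l)"
  have r: "0 \<le> r" "r < 2 * int l" using assms(1) by (auto simp: r_def)
  have fr: "f r = f 0"
    using L.periodic[of r "(2 * int m) div (2 * int l)"] period
    unfolding r_def mod_mult_div_eq by simp
  have "r = 0"
  proof (cases "r \<le> int l")
    case True
    then have "ht (f r) = ht (f 0) + r"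
      using assms(2) r(1) by (auto simp: ascending_def dest: spec[of _ "nat r"])
    then show ?thesis using fr by simp
  next
    case False
    \<comment> \<open>Beyond the top the point is reached from the other side, on the rising path of
      the mirrored walk.\<close>
    have "f r = f (r - 2 * int l)" using L.periodic[of r "-1"] by simp
    moreover have "ht (f (- (2 * int l - r))) = ht (f 0) + (2 * int l - r)"
      using assms(3) False r(2) by (auto simp: M.ascending_def dest: spec[of _ "nat (2 * int l - r)"])
    ultimately show ?thesis using fr r(2) by simp
  qed
  then have "2 * int l dvd 2 * int m" by (auto simp: r_def)
  then show ?thesis by simp
qed

text \<open>Loops at both ends make the walk run up and down a path of \<open>Suc k\<close> points,
  with period \<open>2 * Suc k\<close>. The argument with remainders then works as for a cycle, up
  to parity.\<close>

lemma dvd_of_loops: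
  assumes "ascending k" "f (- 1) = f 0" "f (int k + 1) = f (int k)"
  shows "Suc k dvd m"
proof -
  have refl: "f (2 * int k + 1 - i) = f i" for i
    using shift_odd[of "int k + 1" "int k" "int k - i"] assms(3) by (simp add: algebra_simps)
  interpret L: dihedral_walk f ht "Suc k"
    using refl[of "- 1"] assms(2) by (intro change_period) (simp_all add: algebra_simps)
  define r where "r = (2 * int m) mod (2 * int (Suc k))"
  have r: "0 \<le> r" "r < 2 * int (Suc k)" by (simp_all add: r_def)
  \<comment> \<open>Within one period the walk is at \<open>f 0\<close> also at position
    \<open>2 * k + 1\<close>; parity excludes that position.\<close>
  have "even r" by (simp add: r_def dvd_mod_iff)
  have fr: "f r = f 0"
    using L.periodic[of r "(2 * int m) div (2 * int (Suc k))"] period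
    unfolding r_def mod_mult_div_eq by simp
  have asc: "ht (f i) = ht (f 0) + i" if "0 \<le> i" "i \<le> int k" for i
    using assms(1) that by (auto simp: ascending_def dest: spec[of _ "nat i"])
  have "r = 0"
  proof (cases "r \<le> int k")
    case True
    then show ?thesis using asc[of r] r(1) fr by simp
  next
    case False
    then have "r = 2 * int k + 1" using asc[of "2 * int k + 1 - r"] r(2) fr refl[of r] by simp
    then show ?thesis using \<open>even r\<close> by simp
  qed
  then have "2 * int (Suc k) dvd 2 * int m" by (auto simp: r_def)
  then have "int (Suc k) dvd int m" by (rule dvd_mult_cancel_left[THEN iffD1, THEN disjE]) simp_all
  then show ?thesis by (simp only: int_dvd_int_iff)
qed

text \<open>If \<open>l > 0\<close>, then \<open>exchange\<close>, applied to the point following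
  the left top and the point of equal height to that top on the right, forces the paths to meet. If
  \<open>l = 0\<close>, minimality gives a loop at \<open>f 0\<close>; the path reflected in this
  loop then rules out a descent after the right top, which leaves a loop there too.\<close>

lemma shape_aux:
  assumes min: "\<And>i. ht (f 0) \<le> ht (f i)"
    and k: "ascending k" "ht (f (int k + 1)) \<le> ht (f (int k))"
    and l: "dihedral_walk.ascending (\<lambda>i. f (- i)) ht l" "ht (f (- int l - 1)) \<le> ht (f (- int l))"
    and "l \<le> k"
  shows "(l > 0 \<and> f (int l) = f (- int l)) \<or> (f (- 1) = f 0 \<and> f (int k + 1) = f (int k))"
proof -
  interpret M: dihedral_walk "\<lambda>i. f (- i)" ht m by (rule mirror)
  have up: "ht (f i) = ht (f 0) + i" if "0 \<le> i" "i \<le> int k" for i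
    using k(1) that by (auto simp: ascending_def dest: spec[of _ "nat i"])
  have dn: "ht (f (- i)) = ht (f 0) + i" if "0 \<le> i" "i \<le> int l" for i
    using l(1) that by (auto simp: M.ascending_def dest: spec[of _ "nat i"])
  show ?thesis
  proof (cases "l = 0")
    case False
    \<comment> \<open>Equality would identify two points at heights \<open>l - 1\<close> and
      \<open>l\<close> above the start.\<close>
    have "ht (f (- int l - 1)) \<noteq> ht (f (- int l))"
    proof
      assume "ht (f (- int l - 1)) = ht (f (- int l))"
      then have "f (int l) = f (- int l - 1)"
        using up[of "int l"] dn[of "int l"] \<open>l \<le> k\<close> by (intro eq_if_ht_eq) auto
      then have "f (int l - 1) = f (- int l)"
        using shift_odd[of "int l" "- int l - 1" "- 1"] by simp
      then show False
        using up[of "int l - 1"] dn[of "int l"] \<open>l \<le> k\<close> False by auto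
    qed
    then have "f (int l) = f (- int l - 1 + 1)"
      using up[of "int l"] up[of "int l - 1"] dn[of "int l"] l(2) \<open>l \<le> k\<close> False
      by (intro exchange) auto
    then show ?thesis using False by simp
  next
    case True
    then have f0: "f (- 1) = f 0"
      using l(2) min[of "- 1"] by (intro eq_if_ht_eq) auto
    have refl: "f (- 1 - i) = f i" for i
      using shift_odd[of 0 "- 1" i] f0 by simp
    have "f (int k + 1) = f (int k)"
    proof (rule ccontr)
      assume ne: "f (int k + 1) \<noteq> f (int k)"
      have "ht (f (int k + 1)) \<noteq> ht (f (int k))"
        using eq_if_ht_eq[of "int k + 1" "int k"] ne by auto
      then have h: "ht (f (int k + 1)) = ht (f 0) + int k - 1"
        using k(2) scaled[of "int k"] up[of "int k"] by simp
      then have "k > 0" using min[of "int k + 1"] by simp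
      have "f (int k + 1) = f (- int k)"
        using h refl[of "int k - 1"] up[of "int k - 1"] \<open>k > 0\<close> by (intro eq_if_ht_eq) auto
      then have "f (int k) = f (int k - 2)"
        using refl[of "int k - 1"] shift_even[of "int k + 1" "int k - 1" "- 1"] by simp
      \<comment> \<open>For \<open>k = 1\<close> the position \<open>int k - 2\<close> is
        \<open>- 1\<close>, outside the range of \<open>up\<close>; there the loop \<open>f0\<close>
        supplies the height.\<close>
      then show False
        using up[of "int k"] up[of "int k - 2"] up[of 0] f0 \<open>k > 0\<close> by (cases "k = 1") auto
    qed
    then show ?thesis using f0 by simp
  qed
qed

text \<open>
  From a point of minimal height, the orbit looks either like the Bruhat order of a dihedral group
  of order \<open>2 n\<close> or like that of its quotient by a parabolic subgroup generated by one reflection.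
\<close>

lemma shape:
  assumes min: "\<And>i. ht (f 0) \<le> ht (f i)"
  obtains n where "n > 0" "n dvd m" "f (int n) = f (- int n)"
      "\<And>i. i < n \<Longrightarrow> ht (f (int i)) < ht (f (int i + 1))"
      "\<And>i. i < n \<Longrightarrow> ht (f (- int i)) < ht (f (- int i - 1))"
  | k where "Suc k dvd m" "f (- 1) = f 0" "f (int k + 1) = f (int k)"
      "\<And>i. i < k \<Longrightarrow> ht (f (int i)) < ht (f (int i + 1))"
  | k where "Suc k dvd m" "f 1 = f 0" "f (- int k - 1) = f (- int k)"
      "\<And>i. i < k \<Longrightarrow> ht (f (- int i)) < ht (f (- int i - 1))"
proof -
  interpret M: dihedral_walk "\<lambda>i. f (- i)" ht m by (rule mirror)
  obtain k where k: "ascending k" "ht (f (int k + 1)) \<le> ht (f (int k))"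
    using ex_peak by blast
  obtain l where l: "M.ascending l" "ht (f (- int l - 1)) \<le> ht (f (- int l))"
    using M.ex_peak by auto
  have up: "ht (f (int i)) < ht (f (int i + 1))" if "i < k" for i
  proof -
    have "ht (f (int i)) = ht (f 0) + int i" "ht (f (int (Suc i))) = ht (f 0) + int (Suc i)"
      using k(1) that unfolding ascending_def by (meson Suc_leI less_imp_le)+
    then show ?thesis by (simp add: add.commute)
  qed
  have dn: "ht (f (- int i)) < ht (f (- int i - 1))" if "i < l" for i
  proof -
    have "ht (f (- int i)) = ht (f 0) + int i" "ht (f (- int (Suc i))) = ht (f 0) + int (Suc i)"
      using l(1) that unfolding M.ascending_def minus_zero by (meson Suc_leI less_imp_le)+
    moreover have "- int (Suc i) = - int i - 1" by simp
    ultimately show ?thesis by (simp del: of_nat_Suc)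
  qed
  show thesis
  proof (cases "l \<le> k")
    case True
    from shape_aux[OF min k l True] show thesis
    proof (elim disjE conjE)
      assume *: "l > 0" "f (int l) = f (- int l)"
      have "ascending l" using k(1) True by (auto simp: ascending_def)
      from dvd_of_cycle[OF *(1) this l(1) *(2)] show thesis
        by (rule that(1)[OF *(1) _ *(2)]) (use True in \<open>auto intro: up dn\<close>)
    next
      assume *: "f (- 1) = f 0" "f (int k + 1) = f (int k)"
      from dvd_of_loops[OF k(1) *] show thesis by (rule that(2)[OF _ *]) (rule up)
    qed
  next
    case False
    then have "k \<le> l" by simp
    \<comment> \<open>Here the left path is the longer one, and the mirrored walk exchanges the
      roles.\<close>
    have "(k > 0 \<and> f (- int k) = f (int k)) \<or> (f 1 = f 0 \<and> f (- int l - 1) = f (- int l))"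
      using M.shape_aux[of l k] min k l \<open>k \<le> l\<close>
      by (simp add: add.commute minus_diff_commute)
    then show thesis
    proof (elim disjE conjE)
      assume *: "k > 0" "f (- int k) = f (int k)"
      have "M.ascending k" using l(1) \<open>k \<le> l\<close> by (auto simp: M.ascending_def)
      from dvd_of_cycle[OF *(1) k(1) this *(2)[symmetric]] show thesis
        by (rule that(1)[OF *(1) _ *(2)[symmetric]]) (use \<open>k \<le> l\<close> in \<open>auto intro: up dn\<close>)
    next
      assume *: "f 1 = f 0" "f (- int l - 1) = f (- int l)"
      have "Suc l dvd m" using M.dvd_of_loops[OF l(1)] * by (simp add: minus_diff_commute)
      then show thesis by (rule that(3)[OF _ *]) (rule dn)
    qed
  qed
qed

end


section \<open>Dihedral subgroups of Coxeter groups\<close>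

text \<open>For involutions \<open>s\<close>, \<open>t\<close> this is the alternating product of
  \<open>\<bar>i\<bar>\<close> letters whose rightmost factor is \<open>s\<close> if
  \<open>i > 0\<close> and \<open>t\<close> if \<open>i < 0\<close>. Since \<open>div\<close> rounds
  down, \<open>i = - 1\<close> gives \<open>t\<close>.\<close>

definition (in group) dihedral_elt :: "'a \<Rightarrow> 'a \<Rightarrow> int \<Rightarrow> 'a" where
  "dihedral_elt s t i =
    (if even i then (t \<otimes> s) [^] (i div 2) else s \<otimes> (t \<otimes> s) [^] (i div 2))"

lemma (in group) dihedral_elt_0 [simp]: "dihedral_elt s t 0 = \<one>"
  by (simp add: dihedral_elt_def)

lemma (in group) dihedral_elt_closed [simp]:
  "s \<in> carrier G \<Longrightarrow> t \<in> carrier G \<Longrightarrow> dihedral_elt s t i \<in> carrier G"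
  by (simp add: dihedral_elt_def)

lemma (in group) dihedral_elt_mult:
  assumes st: "s \<in> carrier G" "t \<in> carrier G" and inv: "s \<otimes> s = \<one>" "t \<otimes> t = \<one>"
  shows "s \<otimes> dihedral_elt s t i = dihedral_elt s t (if even i then i + 1 else i - 1)"
    and "t \<otimes> dihedral_elt s t i = dihedral_elt s t (if even i then i - 1 else i + 1)"
proof -
  have cancel: "g \<otimes> (g \<otimes> h) = h" if "g \<in> {s, t}" "h \<in> carrier G" for g h
    using that st inv by (auto simp flip: m_assoc)
  show "s \<otimes> dihedral_elt s t i = dihedral_elt s t (if even i then i + 1 else i - 1)"
    using st by (auto simp: dihedral_elt_def cancel elim!: oddE)
  show "t \<otimes> dihedral_elt s t i = dihedral_elt s t (if even i then i - 1 else i + 1)"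
  proof (cases "even i")
    case True
    then obtain k where k: "i = 2 * k" by blast
    have "(t \<otimes> s) [^] k = (t \<otimes> s) \<otimes> (t \<otimes> s) [^] (k - 1)"
      using st int_pow_mult[of "t \<otimes> s" 1 "k - 1"] by (simp add: int_pow_1)
    moreover have "(2 * k - 1) div 2 = k - 1" by simp
    ultimately show ?thesis
      using st by (simp add: k dihedral_elt_def m_assoc cancel)
  next
    case False
    then obtain k where k: "i = 2 * k + 1" by (blast elim: oddE)
    have "(t \<otimes> s) [^] (k + 1) = (t \<otimes> s) \<otimes> (t \<otimes> s) [^] k"
      using st int_pow_mult[of "t \<otimes> s" 1 k] by (simp add: int_pow_1 add.commute)
    moreover have "(2 * k + 2) div 2 = k + 1" by simp
    ultimately show ?thesis
      using st by (simp add: k dihedral_elt_def m_assoc add.commute)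
  qed
qed

context coxeter_system
begin

lemma S_closed [simp]: "s \<in> S \<Longrightarrow> s \<in> carrier W"
  using S_carrier by blast

lemma S_square [simp]: "s \<in> S \<Longrightarrow> s \<otimes> s = \<one>"
  using pow_ord_eq_1[of s] by (simp add: S_order numeral_2_eq_2)

lemma S_inv [simp]: "s \<in> S \<Longrightarrow> inv s = s"
  by (simp add: inv_equality)

lemma S_subset_reflections: "s \<in> S \<Longrightarrow> s \<in> reflections W S"
  unfolding reflections_def by (rule CollectI, rule exI[of _ "\<one>"], rule exI[of _ s]) simp

lemma reflections_closed: "r \<in> reflections W S \<Longrightarrow> r \<in> carrier W"
  by (auto simp: reflections_def)

lemma reflections_conj:
  assumes "r \<in> reflections W S" "g \<in> carrier W"
  shows "g \<otimes> r \<otimes> inv g \<in> reflections W S"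
proof -
  obtain h s where "r = h \<otimes> s \<otimes> inv h" "h \<in> carrier W" "s \<in> S"
    using assms(1) by (auto simp: reflections_def)
  then have "g \<otimes> r \<otimes> inv g = (g \<otimes> h) \<otimes> s \<otimes> inv (g \<otimes> h)"
    using assms(2) by (simp add: m_assoc inv_mult_group)
  then show ?thesis
    using \<open>h \<in> carrier W\<close> \<open>s \<in> S\<close> assms(2) unfolding reflections_def by blast
qed

text \<open>The rules of \<open>dihedral_elt_mult\<close> sorted by direction instead of by
  letter.\<close>

lemma dihedral_elt_step:
  assumes "s \<in> S" "t \<in> S"
  shows "(if even i then s else t) \<otimes> dihedral_elt s t i = dihedral_elt s t (i + 1)"
    and "(if even i then t else s) \<otimes> dihedral_elt s t i = dihedral_elt s t (i - 1)"
  using assms by (auto simp: dihedral_elt_mult)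

text \<open>Induction on the distance, from the inside out: neighbours are exchanged by a letter,
  and conjugation with the letter leading from \<open>i\<close> to \<open>i + 1\<close> widens the
  pair by one step on both sides. Both equations are kept because the two positions may later come
  in either order.\<close>

lemma dihedral_reflection_aux:
  assumes st: "s \<in> S" "t \<in> S"
  shows "\<exists>r\<in>reflections W S. r \<otimes> dihedral_elt s t i = dihedral_elt s t (i + 1 + 2 * int n) \<and>
    r \<otimes> dihedral_elt s t (i + 1 + 2 * int n) = dihedral_elt s t i"
proof (induction n arbitrary: i)
  case 0
  let ?g = "if even i then s else t"
  show ?case
    using st dihedral_elt_step(1)[OF st, of i] dihedral_elt_step(2)[OF st, of "i + 1"]
    by (intro bexI[of _ ?g]) (auto intro: S_subset_reflections)
next
  case (Suc n)
  let ?g = "if even i then s else t" and ?d = "dihedral_elt s t" and ?j = "i + 2 + 2 * int n"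
  have g: "?g \<in> carrier W" "inv ?g = ?g" using st by auto
  obtain r where r: "r \<in> reflections W S" "r \<otimes> ?d (i + 1) = ?d ?j" "r \<otimes> ?d ?j = ?d (i + 1)"
    using Suc.IH[of "i + 1"] by (auto simp: add.assoc)
  have rc: "r \<in> carrier W" by (rule reflections_closed) fact
  \<comment> \<open>\<open>i\<close> and \<open>?j\<close> have the same parity, so the one letter
    \<open>?g\<close> leads forward from both.\<close>
  have steps: "?g \<otimes> ?d i = ?d (i + 1)" "?g \<otimes> ?d (i + 1) = ?d i"
    "?g \<otimes> ?d ?j = ?d (?j + 1)" "?g \<otimes> ?d (?j + 1) = ?d ?j"
    using dihedral_elt_step(1)[OF st, of i] dihedral_elt_step(2)[OF st, of "i + 1"]
      dihedral_elt_step(1)[OF st, of ?j] dihedral_elt_step(2)[OF st, of "?j + 1"]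
    by (cases "even i"; simp add: algebra_simps)+
  have j: "i + 1 + 2 * int (Suc n) = ?j + 1" by simp
  have "?g \<otimes> r \<otimes> inv ?g \<in> reflections W S"
    using reflections_conj r(1) g(1) by blast
  moreover have "(?g \<otimes> r \<otimes> inv ?g) \<otimes> ?d i = ?d (?j + 1)"
    "(?g \<otimes> r \<otimes> inv ?g) \<otimes> ?d (?j + 1) = ?d i"
    using g(1) rc st by (simp_all only: g(2) m_assoc m_closed dihedral_elt_closed S_closed steps r)
  ultimately show ?case unfolding j by blast
qed

lemma dihedral_reflection:
  assumes st: "s \<in> S" "t \<in> S" and "odd (i + j)"
  obtains r where "r \<in> reflections W S" "r \<otimes> dihedral_elt s t i = dihedral_elt s t j"
proof (cases "i < j")
  case True
  moreover obtain k where "j - i = 2 * k + 1"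
    using assms(3) by (metis even_add odd_iff_mod_2_eq_one oddE even_diff)
  ultimately have "j = i + 1 + 2 * int (nat k)" by simp
  then show thesis using dihedral_reflection_aux[OF st, of i "nat k"] that by auto
next
  case False
  moreover obtain k where "i - j = 2 * k + 1"
    using assms(3) by (metis even_add odd_iff_mod_2_eq_one oddE even_diff)
  ultimately have "i = j + 1 + 2 * int (nat k)" by simp
  then show thesis using dihedral_reflection_aux[OF st, of j "nat k"] that by auto
qed

end

context quasiparabolic_W_set
begin

section \<open>Walks in a quasiparabolic set\<close>

lemma action_closed [simp]: "g \<in> carrier W \<Longrightarrow> x \<in> X \<Longrightarrow> \<phi> g x \<in> X"
  by (rule element_image) auto

lemma action_mult: "g \<in> carrier W \<Longrightarrow> h \<in> carrier W \<Longrightarrow> x \<in> X \<Longrightarrow> \<phi> (g \<otimes> h) x = \<phi> g (\<phi> h x)"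
  by (rule composition_rule)

lemma action_one [simp]: "x \<in> X \<Longrightarrow> \<phi> \<one> x = x"
  using id_eq_one by (metis restrict_apply')

lemma S_action_twice [simp]: "s \<in> S \<Longrightarrow> x \<in> X \<Longrightarrow> \<phi> s (\<phi> s x) = x"
  by (simp flip: action_mult)

definition walk :: "'a \<Rightarrow> 'a \<Rightarrow> 'c \<Rightarrow> int \<Rightarrow> 'c" where
  "walk s t x i = \<phi> (dihedral_elt s t i) x"

context
  fixes s t x
  assumes st [simp]: "s \<in> S" "t \<in> S" and x [simp]: "x \<in> X"
begin

lemma walk_closed [simp]: "walk s t x i \<in> X"
  by (simp add: walk_def)

lemma walk_0 [simp]: "walk s t x 0 = x"
  by (simp add: walk_def)

lemma walk_step:
  "\<phi> (if even i then s else t) (walk s t x i) = walk s t x (i + 1)"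
  "\<phi> (if even i then t else s) (walk s t x i) = walk s t x (i - 1)"
  using dihedral_elt_step[OF st, of i] by (auto simp: walk_def simp flip: action_mult)

lemma walk_induct:
  assumes "P x" "\<And>y. P y \<Longrightarrow> P (\<phi> s y)" "\<And>y. P y \<Longrightarrow> P (\<phi> t y)"
  shows "P (walk s t x i)"
proof (induction i rule: int_induct[where k = 0])
  case (step1 i)
  then show ?case using assms walk_step(1)[of i] by metis
next
  case (step2 i)
  then show ?case using assms walk_step(2)[of i] by metis
qed (simp add: assms)

lemma walk_reflection:
  assumes "odd (i + j)"
  obtains r where "r \<in> reflections W S" "\<phi> r (walk s t x i) = walk s t x j"
proof -
  obtain r where "r \<in> reflections W S" "r \<otimes> dihedral_elt s t i = dihedral_elt s t j"
    using dihedral_reflection[OF st assms] .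
  then show thesis
    by (intro that[of r]) (auto simp: walk_def reflections_closed simp flip: action_mult)
qed

text \<open>The exchange conditions are (QP2) for a reflection taking \<open>f i\<close> to
  \<open>f j\<close> and the letter leading from \<open>i\<close> to its neighbour in question: as
  \<open>i + j\<close> is odd, that letter leads from \<open>j\<close> in the opposite
  direction.\<close>

lemma dihedral_walk:
  assumes m: "ord (s \<otimes> t) > 0"
  shows "dihedral_walk (walk s t x) ht (ord (s \<otimes> t))"
proof
  let ?f = "walk s t x" and ?m = "ord (s \<otimes> t)"
  \<comment> \<open>The walk is built from powers of \<open>t \<otimes> s\<close>, whereas
    \<open>m\<close> is the order of \<open>s \<otimes> t\<close>.\<close>
  have "t \<otimes> s = inv (s \<otimes> t)"
    by (simp add: inv_mult_group)
  then have "(t \<otimes> s) [^] (int ?m) = \<one>"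
    by (simp add: int_pow_int nat_pow_inv)
  then show "?f (2 * int ?m) = ?f 0"
    by (simp add: walk_def dihedral_elt_def)
  show "\<bar>ht (?f (i + 1)) - ht (?f i)\<bar> \<le> 1" for i
    using walk_step(1)[of i] ht_scaled[of "if even i then s else t" "?f i"] by simp
  show "?f i = ?f j" if odd: "odd (i + j)" and ht: "ht (?f i) = ht (?f j)" for i j
  proof -
    obtain r where "r \<in> reflections W S" "\<phi> r (?f i) = ?f j" using walk_reflection[OF odd] .
    then show ?thesis using QP1[of r "?f i"] ht by simp
  qed
  show "?f j = ?f (i + 1)"
    if odd: "odd (i + j)" and ht: "ht (?f i) < ht (?f j)" "ht (?f (j - 1)) < ht (?f (i + 1))" for i j
  proof -
    obtain r where "r \<in> reflections W S" "\<phi> r (?f i) = ?f j" using walk_reflection[OF odd] .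
    then show ?thesis
      using QP2[of r "?f i" "if even i then s else t"] ht odd walk_step(1)[of i] walk_step(2)[of j]
      by (auto split: if_splits)
  qed
  show "?f j = ?f (i - 1)"
    if odd: "odd (i + j)" and ht: "ht (?f i) < ht (?f j)" "ht (?f (j + 1)) < ht (?f (i - 1))" for i j
  proof -
    obtain r where "r \<in> reflections W S" "\<phi> r (?f i) = ?f j" using walk_reflection[OF odd] .
    then show ?thesis
      using QP2[of r "?f i" "if even i then t else s"] ht odd walk_step(2)[of i] walk_step(1)[of j]
      by (auto split: if_splits)
  qed
  show "?f (i + 1) = ?f (j + 1)" if "even (i + j)" "?f i = ?f j" for i j
    using that walk_step(1)[of i] walk_step(1)[of j] by (auto split: if_splits)
  show "?f (i - 1) = ?f (j - 1)" if "even (i + j)" "?f i = ?f j" for i j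
    using that walk_step(2)[of i] walk_step(2)[of j] by (auto split: if_splits)
  show "?f (i + 1) = ?f (j - 1)" if "odd (i + j)" "?f i = ?f j" for i j
    using that walk_step(1)[of i] walk_step(2)[of j] by (auto split: if_splits)
qed (rule m)

end


section \<open>The operators on \<open>T(X)\<close>\<close>

lemma T_op_T_basis [simp]: "T_op \<phi> ht \<epsilon> s (T_basis x) = T_op_basis \<phi> ht \<epsilon> s x"
  by (simp add: T_op_eq_T_extend T_basis_def)

lemma fixed_if_ht_eq: "s \<in> S \<Longrightarrow> x \<in> X \<Longrightarrow> ht (\<phi> s x) = ht x \<Longrightarrow> \<phi> s x = x"
  by (rule QP1[OF S_subset_reflections])

lemma T_linear_T_op: "T_linear (T_op \<phi> ht \<epsilon> s)"
  unfolding T_op_eq_T_extend by (rule T_linear_T_extend)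

lemma T_op_closed:
  assumes "s \<in> S" "Poly_Mapping.keys v \<subseteq> X"
  shows "Poly_Mapping.keys (T_op \<phi> ht \<epsilon> s v) \<subseteq> X"
  unfolding T_op_eq_T_extend
proof (rule keys_T_extend)
  fix x assume "x \<in> Poly_Mapping.keys v"
  then have x: "x \<in> X" "\<phi> s x \<in> X" using assms by auto
  have *: "Poly_Mapping.keys (T_scale c (T_basis y)) \<subseteq> X" if "y \<in> X" for c y
    using that keys_T_scale[of c "T_basis y"] by (auto simp: T_basis_def)
  \<comment> \<open>The instance of \<open>*\<close> with scalar \<open>1\<close> covers ascents,
    where the basis element stands unscaled.\<close>
  show "Poly_Mapping.keys (T_op_basis \<phi> ht \<epsilon> s x) \<subseteq> X"
    unfolding T_op_basis_def
    using *[OF x(1)] *[OF x(2)] *[OF x(2), of 1]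
      Poly_Mapping.keys_add[of "T_scale (q_var - 1) (T_basis x)" "T_scale q_var (T_basis (\<phi> s x))"]
    by (simp; blast)
qed

context
  fixes \<epsilon> :: "int poly"
  assumes \<epsilon>: "\<epsilon> \<in> {\<epsilon>_plus, \<epsilon>_minus}"
begin

text \<open>Both signs give roots of \<open>(z - q) (z + 1)\<close>, which is the quadratic relation
  on a point fixed by the generator.\<close>

lemma \<epsilon>_square: "\<epsilon> * \<epsilon> = (q_var - 1) * \<epsilon> + q_var"
  using \<epsilon> by (auto simp: \<epsilon>_plus_def \<epsilon>_minus_def algebra_simps)

text \<open>On basis elements: an ascent and a descent undo each other because
  \<open>\<phi> s\<close> is an involution, and a loop is settled by
  \<open>\<epsilon>_square\<close>.\<close>

lemma T_op_quadratic:
  assumes s: "s \<in> S" and v: "Poly_Mapping.keys v \<subseteq> X"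
  shows "T_op \<phi> ht \<epsilon> s (T_op \<phi> ht \<epsilon> s v)
    = T_scale (q_var - 1) (T_op \<phi> ht \<epsilon> s v) + T_scale q_var v"
proof (rule T_linear_eqI[where v = v and A = "\<lambda>v. T_op \<phi> ht \<epsilon> s (T_op \<phi> ht \<epsilon> s v)"
      and B = "\<lambda>v. T_scale (q_var - 1) (T_op \<phi> ht \<epsilon> s v) + T_scale q_var v"])
  interpret A: T_linear "T_op \<phi> ht \<epsilon> s" by (rule T_linear_T_op)
  show "T_linear (\<lambda>v. T_op \<phi> ht \<epsilon> s (T_op \<phi> ht \<epsilon> s v))"
    by unfold_locales (simp_all add: A.add A.scale)
  show "T_linear (\<lambda>v. T_scale (q_var - 1) (T_op \<phi> ht \<epsilon> s v) + T_scale q_var v)"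
    by unfold_locales (simp_all add: A.add A.scale T_scale_add mult.commute algebra_simps)
  fix x assume "x \<in> Poly_Mapping.keys v"
  with v have x: "x \<in> X" by blast
  consider "ht (\<phi> s x) > ht x" | "ht (\<phi> s x) = ht x" "\<phi> s x = x" | "ht (\<phi> s x) < ht x"
    using fixed_if_ht_eq[OF s x] by linarith
  then show "T_op \<phi> ht \<epsilon> s (T_op \<phi> ht \<epsilon> s (T_basis x))
      = T_scale (q_var - 1) (T_op \<phi> ht \<epsilon> s (T_basis x)) + T_scale q_var (T_basis x)"
  proof cases
    case 2
    then show ?thesis
      by (simp add: T_op_basis_def A.scale \<epsilon>_square T_scale_add_left)
  qed (use s x in \<open>simp_all add: T_op_basis_def A.add A.scale\<close>)
qed

section \<open>The braid relation for two generators\<close>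

context
  fixes s t
  assumes st [simp]: "s \<in> S" "t \<in> S"
begin

interpretation quadratic_operators "T_op \<phi> ht \<epsilon>" s t "{v. Poly_Mapping.keys v \<subseteq> X}"
proof unfold_locales
  fix r and v :: "'c \<Rightarrow>\<^sub>0 int poly"
  assume r: "r \<in> {s, t}" and v: "v \<in> {v. Poly_Mapping.keys v \<subseteq> X}"
  have "r \<in> S" using r st by blast
  then show "T_op \<phi> ht \<epsilon> r v \<in> {v. Poly_Mapping.keys v \<subseteq> X}"
    "T_op \<phi> ht \<epsilon> r (T_op \<phi> ht \<epsilon> r v) = T_scale (q_var - 1) (T_op \<phi> ht \<epsilon> r v) + T_scale q_var v"
    using T_op_closed T_op_quadratic v by simp_all
next
  fix r
  interpret T_linear "T_op \<phi> ht \<epsilon> r" by (rule T_linear_T_op)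
  show "T_op \<phi> ht \<epsilon> r (u + v) = T_op \<phi> ht \<epsilon> r u + T_op \<phi> ht \<epsilon> r v"
    "T_op \<phi> ht \<epsilon> r (T_scale c v) = T_scale c (T_op \<phi> ht \<epsilon> r v)"
    for u v :: "'c \<Rightarrow>\<^sub>0 int poly" and c
    by (simp_all add: add scale)
qed

text \<open>Only a descent needs work: the image of \<open>T_basis y\<close> contains
  \<open>T_basis (\<phi> r y)\<close> with coefficient \<open>q_var\<close>, so subtract the
  multiple of \<open>T_basis y\<close> and cancel \<open>q_var\<close>.\<close>

lemma T_basis_braid_kernel_step:
  assumes "y \<in> X" "r \<in> {s, t}" "T_basis y \<in> braid_kernel (T_op \<phi> ht \<epsilon>) s t n"
  shows "T_basis (\<phi> r y) \<in> braid_kernel (T_op \<phi> ht \<epsilon>) s t n"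
proof -
  let ?K = "braid_kernel (T_op \<phi> ht \<epsilon>) s t n"
  have "r \<in> S" using assms(2) st by blast
  have K: "T_op_basis \<phi> ht \<epsilon> r y \<in> ?K"
    using braid_kernel_closed[OF _ assms(3,2)] assms(1) by (simp add: T_basis_def[of y])
      (simp flip: T_basis_def)
  consider "ht (\<phi> r y) > ht y" | "ht (\<phi> r y) = ht y" "\<phi> r y = y" | "ht (\<phi> r y) < ht y"
    using fixed_if_ht_eq[OF \<open>r \<in> S\<close> assms(1)] by linarith
  then show ?thesis
  proof cases
    case 3
    then have "T_op_basis \<phi> ht \<epsilon> r y - T_scale (q_var - 1) (T_basis y)
        = T_scale q_var (T_basis (\<phi> r y))"
      by (simp add: T_op_basis_def)
    then have "T_scale q_var (T_basis (\<phi> r y)) \<in> ?K"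
      using braid_kernel_submodule(1)[OF K braid_kernel_submodule(2)[OF assms(3)]] by metis
    then show ?thesis by (rule braid_kernel_submodule(3))
  qed (use K assms(3) in \<open>simp_all add: T_op_basis_def\<close>)
qed

text \<open>The letters act in the order of the walk, and on an ascent an operator merely moves the
  basis element along.\<close>

lemma fold_ascending:
  assumes x: "x \<in> X"
    and "\<And>i. i < n \<Longrightarrow> ht (walk s t x (int i)) < ht (walk s t x (int i + 1))"
  shows "fold (T_op \<phi> ht \<epsilon>) (alternating n s t) (T_basis x) = T_basis (walk s t x (int n))"
  using assms(2)
proof (induction n)
  case (Suc n)
  then show ?case
    using walk_step(1)[OF st x, of "int n"]
    by (auto simp: alternating_Suc_snoc T_op_basis_def add.commute simp del: alternating.simps
        split: if_splits)
qed (simp add: x)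

text \<open>The positions descend, but the heights still rise: this is the path to the left,
  beginning with \<open>t\<close>.\<close>

lemma fold_descending:
  assumes x: "x \<in> X"
    and "\<And>i. i < n \<Longrightarrow> ht (walk s t x (- int i)) < ht (walk s t x (- int i - 1))"
  shows "fold (T_op \<phi> ht \<epsilon>) (alternating n t s) (T_basis x) = T_basis (walk s t x (- int n))"
  using assms(2)
proof (induction n)
  case (Suc n)
  have *: "- int (Suc n) = - int n - 1" by simp
  show ?case
    using Suc walk_step(2)[OF st x, of "- int n"] unfolding *
    by (auto simp: alternating_Suc_snoc T_op_basis_def simp del: alternating.simps of_nat_Suc
        split: if_splits)
qed (simp add: x)

lemma T_op_basis_loop: "\<phi> r y = y \<Longrightarrow> T_op_basis \<phi> ht \<epsilon> r y = T_scale \<epsilon> (T_basis y)"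
  by (simp add: T_op_basis_def)

lemma fold_T_op_scale:
  "fold (T_op \<phi> ht \<epsilon>) w (T_scale c v) = T_scale c (fold (T_op \<phi> ht \<epsilon>) w v)"
proof -
  interpret L: T_linear "foldr (T_op \<phi> ht \<epsilon>) (rev w)"
    by (rule T_linear_foldr) (rule linear)
  show ?thesis using L.scale by (simp add: foldr_conv_fold)
qed

lemma braid_kernel_min:
  assumes m: "ord (s \<otimes> t) > 0" and x: "x \<in> X"
    and min: "\<And>i. ht x \<le> ht (walk s t x i)"
  shows "T_basis x \<in> braid_kernel (T_op \<phi> ht \<epsilon>) s t (ord (s \<otimes> t))"
proof -
  interpret D: dihedral_walk "walk s t x" ht "ord (s \<otimes> t)"
    by (rule dihedral_walk) (simp_all add: x m)
  have xC: "T_basis x \<in> {v. Poly_Mapping.keys v \<subseteq> X}" using x by (simp add: T_basis_def)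
  from min have "\<And>i. ht (walk s t x 0) \<le> ht (walk s t x i)" by (simp add: x)
  then show ?thesis
  proof (rule D.shape)
    fix n
    assume n: "n dvd ord (s \<otimes> t)" "walk s t x (int n) = walk s t x (- int n)"
      "\<And>i. i < n \<Longrightarrow> ht (walk s t x (int i)) < ht (walk s t x (int i + 1))"
      "\<And>i. i < n \<Longrightarrow> ht (walk s t x (- int i)) < ht (walk s t x (- int i - 1))"
    have "T_basis x \<in> braid_kernel (T_op \<phi> ht \<epsilon>) s t n"
      unfolding braid_kernel_iff_fold by (simp add: fold_ascending fold_descending x n)
    then show ?thesis using braid_kernel_dvd[OF xC] n(1) by blast
  next
    fix k
    assume k: "Suc k dvd ord (s \<otimes> t)" "walk s t x (- 1) = walk s t x 0"
      "walk s t x (int k + 1) = walk s t x (int k)"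
      "\<And>i. i < k \<Longrightarrow> ht (walk s t x (int i)) < ht (walk s t x (int i + 1))"
    \<comment> \<open>The word beginning with \<open>t\<close> meets the loop at \<open>x\<close>
      and then climbs \<open>k\<close> steps; the other word climbs first and meets the loop at the
      top. Either way \<open>\<epsilon>\<close> appears exactly once.\<close>
    have "\<phi> t x = x" using walk_step(2)[OF st x, of 0] k(2) by (simp add: x)
    then have "fold (T_op \<phi> ht \<epsilon>) (alternating (Suc k) t s) (T_basis x)
        = T_scale \<epsilon> (T_basis (walk s t x (int k)))"
      by (simp add: T_op_basis_loop fold_T_op_scale fold_ascending x k)
    moreover have "fold (T_op \<phi> ht \<epsilon>) (alternating (Suc k) s t) (T_basis x)
        = T_scale \<epsilon> (T_basis (walk s t x (int k)))"
      using walk_step(1)[OF st x, of "int k"] k(3)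
      by (auto simp: alternating_Suc_snoc fold_ascending x k(4) T_op_basis_loop
          simp del: alternating.simps)
    ultimately have "T_basis x \<in> braid_kernel (T_op \<phi> ht \<epsilon>) s t (Suc k)"
      unfolding braid_kernel_iff_fold by (simp only:)
    then show ?thesis using braid_kernel_dvd[OF xC] k(1) by blast
  next
    fix k
    assume k: "Suc k dvd ord (s \<otimes> t)" "walk s t x 1 = walk s t x 0"
      "walk s t x (- int k - 1) = walk s t x (- int k)"
      "\<And>i. i < k \<Longrightarrow> ht (walk s t x (- int i)) < ht (walk s t x (- int i - 1))"
    have "\<phi> s x = x" using walk_step(1)[OF st x, of 0] k(2) by (simp add: x)
    then have "fold (T_op \<phi> ht \<epsilon>) (alternating (Suc k) s t) (T_basis x)
        = T_scale \<epsilon> (T_basis (walk s t x (- int k)))"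
      by (simp add: T_op_basis_loop fold_T_op_scale fold_descending x k)
    moreover have "fold (T_op \<phi> ht \<epsilon>) (alternating (Suc k) t s) (T_basis x)
        = T_scale \<epsilon> (T_basis (walk s t x (- int k)))"
      using walk_step(2)[OF st x, of "- int k"] k(3)
      by (auto simp: alternating_Suc_snoc fold_descending x k(4) T_op_basis_loop
          simp del: alternating.simps)
    ultimately have "T_basis x \<in> braid_kernel (T_op \<phi> ht \<epsilon>) s t (Suc k)"
      unfolding braid_kernel_iff_fold by (simp only:)
    then show ?thesis using braid_kernel_dvd[OF xC] k(1) by blast
  qed
qed

lemma T_basis_braid_kernel:
  assumes m: "ord (s \<otimes> t) > 0" and x: "x \<in> X"
  shows "T_basis x \<in> braid_kernel (T_op \<phi> ht \<epsilon>) s t (ord (s \<otimes> t))"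
proof -
  let ?K = "braid_kernel (T_op \<phi> ht \<epsilon>) s t (ord (s \<otimes> t))" and ?f = "walk s t x"
  interpret D: dihedral_walk ?f ht "ord (s \<otimes> t)"
    by (rule dihedral_walk) (simp_all add: x m)
  obtain i where i: "\<And>j. ht (?f i) \<le> ht (?f j)" using D.ex_min by blast
  have fi: "?f i \<in> X" by (simp add: x)
  \<comment> \<open>The walk restarted at \<open>?f i\<close> stays in the orbit of
    \<open>x\<close>, so \<open>?f i\<close> is minimal on its own walk as well.\<close>
  have "walk s t (?f i) j \<in> range ?f" for j
  proof (rule walk_induct[OF st fi])
    show "\<phi> s y \<in> range ?f" "\<phi> t y \<in> range ?f" if y: "y \<in> range ?f" for y
    proof -
      from y obtain k where "y = ?f k" by blast
      then show "\<phi> s y \<in> range ?f" "\<phi> t y \<in> range ?f"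
        using walk_step[OF st x, of k] by (cases "even k"; simp)+
    qed
  qed simp
  then have "ht (?f i) \<le> ht (walk s t (?f i) j)" for j
    using i by (metis rangeE)
  then have "T_basis (?f i) \<in> ?K" by (intro braid_kernel_min m fi)
  \<comment> \<open>The induction runs from \<open>x\<close> to the minimal point, while membership
    is carried back: applied at \<open>\<phi> r y\<close>, the operator for \<open>r\<close> returns
    to \<open>y\<close>.\<close>
  moreover have "?f i \<in> X \<and> (T_basis (?f i) \<in> ?K \<longrightarrow> T_basis x \<in> ?K)"
  proof (rule walk_induct[OF st x])
    fix y assume y: "y \<in> X \<and> (T_basis y \<in> ?K \<longrightarrow> T_basis x \<in> ?K)"
    have *: "\<phi> r y \<in> X \<and> (T_basis (\<phi> r y) \<in> ?K \<longrightarrow> T_basis x \<in> ?K)" if "r \<in> {s, t}" for r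
    proof -
      have "r \<in> S" using that st by blast
      then show ?thesis
        using T_basis_braid_kernel_step[of "\<phi> r y" r] y that by auto
    qed
    show "\<phi> s y \<in> X \<and> (T_basis (\<phi> s y) \<in> ?K \<longrightarrow> T_basis x \<in> ?K)"
      "\<phi> t y \<in> X \<and> (T_basis (\<phi> t y) \<in> ?K \<longrightarrow> T_basis x \<in> ?K)"
      by (rule *; simp)+
  qed (simp add: x)
  ultimately show ?thesis by blast
qed

lemma T_op_braid:
  assumes "ord (s \<otimes> t) > 0" and v: "Poly_Mapping.keys v \<subseteq> X"
  shows "foldr (T_op \<phi> ht \<epsilon>) (alternating (ord (s \<otimes> t)) s t) v
    = foldr (T_op \<phi> ht \<epsilon>) (alternating (ord (s \<otimes> t)) t s) v"
proof (rule T_linear_eqI[where v = v])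
  fix x assume "x \<in> Poly_Mapping.keys v"
  then show "foldr (T_op \<phi> ht \<epsilon>) (alternating (ord (s \<otimes> t)) s t) (T_basis x)
      = foldr (T_op \<phi> ht \<epsilon>) (alternating (ord (s \<otimes> t)) t s) (T_basis x)"
    using T_basis_braid_kernel[OF assms(1)] v by (auto simp: braid_kernel_def)
qed (rule T_linear_foldr, rule linear)+

end

end

end


section \<open>Modules over algebras given by generators and relations\<close>

text \<open>With \<open>foldr\<close> the last letter acts first, so concatenation of words becomes
  composition, as a left module requires.\<close>

definition free_act ::
    "('w \<Rightarrow> ('x \<Rightarrow>\<^sub>0 int poly) \<Rightarrow> ('x \<Rightarrow>\<^sub>0 int poly)) \<Rightarrow> ('w list \<Rightarrow>\<^sub>0 int poly) \<Rightarrow>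
      ('x \<Rightarrow>\<^sub>0 int poly) \<Rightarrow> ('x \<Rightarrow>\<^sub>0 int poly)" where
  "free_act op f v = T_extend (\<lambda>w. foldr op w v) f"

section \<open>The free algebra and \<open>T(X)\<close> as algebraic structures\<close>

lemma free_algebra_simps [simp]:
  "carrier (free_algebra S) = {f. Poly_Mapping.keys f \<subseteq> lists S}"
  "monoid.mult (free_algebra S) = (*)" "one (free_algebra S) = 1"
  "zero (free_algebra S) = 0" "add (free_algebra S) = (+)"
  by (simp_all add: free_algebra_def)

lemma T_module_simps [simp]:
  "carrier (T_module X) = {v. Poly_Mapping.keys v \<subseteq> X}"
  "zero (T_module X) = 0" "add (T_module X) = (+)" "module.smult (T_module X) = T_scale"
  by (simp_all add: T_module_def)

lemma with_action_simps [simp]: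
  "carrier (with_action M act) = carrier M" "zero (with_action M act) = zero M"
  "add (with_action M act) = add M" "module.smult (with_action M act) = act"
  by (simp_all add: with_action_def)

lemma free_algebra_ring: "ring (free_algebra S)"
proof (rule ringI)
  show "abelian_group (free_algebra S)"
  proof (rule abelian_groupI; simp)
    fix f g :: "'a list \<Rightarrow>\<^sub>0 int poly"
    assume "Poly_Mapping.keys f \<subseteq> lists S"
    then show "\<exists>g. Poly_Mapping.keys g \<subseteq> lists S \<and> g + f = 0"
      by (intro exI[of _ "- f"]) (auto simp: Poly_Mapping.keys_minus)
    assume "Poly_Mapping.keys g \<subseteq> lists S"
    then show "Poly_Mapping.keys (f + g) \<subseteq> lists S"
      using \<open>Poly_Mapping.keys f \<subseteq> lists S\<close> Poly_Mapping.keys_add[of f g] by blast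
  qed
  show "Group.monoid (free_algebra S)"
  proof (rule monoidI; simp)
    fix f g :: "'a list \<Rightarrow>\<^sub>0 int poly"
    assume "Poly_Mapping.keys f \<subseteq> lists S" "Poly_Mapping.keys g \<subseteq> lists S"
    then show "Poly_Mapping.keys (f * g) \<subseteq> lists S"
      using Poly_Mapping.keys_mult[of f g] by (fastforce simp: plus_list_def)
  qed (simp_all add: zero_list_def mult.assoc)
qed (simp_all add: algebra_simps)

lemma free_algebra_minus:
  assumes "Poly_Mapping.keys f \<subseteq> lists S"
  shows "a_inv (free_algebra S) f = - f"
proof -
  interpret ring "free_algebra S" by (rule free_algebra_ring)
  show ?thesis
    by (rule minus_equality) (use assms in \<open>simp_all add: Poly_Mapping.keys_minus\<close>)
qed

lemma T_module_abelian_group: "abelian_group (with_action (T_module X) act)"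
proof (rule abelian_groupI; simp)
  fix u v :: "'a \<Rightarrow>\<^sub>0 int poly"
  assume "Poly_Mapping.keys u \<subseteq> X"
  then show "\<exists>v. Poly_Mapping.keys v \<subseteq> X \<and> v + u = 0"
    by (intro exI[of _ "- u"]) (auto simp: Poly_Mapping.keys_minus)
  assume "Poly_Mapping.keys v \<subseteq> X"
  then show "Poly_Mapping.keys (u + v) \<subseteq> X"
    using \<open>Poly_Mapping.keys u \<subseteq> X\<close> Poly_Mapping.keys_add[of u v] by blast
qed

lemma prod_list_free_gen: "prod_list (map free_gen w) = Poly_Mapping.single w 1"
proof (induction w)
  case Nil
  show ?case by (simp add: single_one[symmetric] zero_list_def del: single_one)
qed (simp add: free_gen_def mult_single plus_list_def)

lemma free_act_single [simp]: "free_act op (Poly_Mapping.single w c) v = T_scale c (foldr op w v)"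
  by (simp add: free_act_def)

lemma free_act_one [simp]: "free_act op 1 v = v"
proof -
  have "free_act op (Poly_Mapping.single 0 1) v = v"
    by (simp only: free_act_single) (simp add: zero_list_def)
  then show ?thesis by (simp only: single_one)
qed

lemma free_act_free_gen [simp]: "free_act op (free_gen s) v = op s v"
  by (simp add: free_gen_def)

lemma free_act_free_scalar [simp]: "free_act op (free_scalar c) v = T_scale c v"
  by (simp add: free_scalar_def)

section \<open>From operators satisfying the relations to a module over the quotient\<close>

locale hecke_operators =
  fixes W :: "('w, 'b) monoid_scheme" and S :: "'w set" and X :: "'x set"
    and op :: "'w \<Rightarrow> ('x \<Rightarrow>\<^sub>0 int poly) \<Rightarrow> ('x \<Rightarrow>\<^sub>0 int poly)"
  assumes linear: "T_linear (op s)"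
    and closed: "\<lbrakk>s \<in> S; Poly_Mapping.keys v \<subseteq> X\<rbrakk> \<Longrightarrow> Poly_Mapping.keys (op s v) \<subseteq> X"
    and quadratic: "\<lbrakk>s \<in> S; Poly_Mapping.keys v \<subseteq> X\<rbrakk> \<Longrightarrow>
      op s (op s v) = T_scale (q_var - 1) (op s v) + T_scale q_var v"
    and braid: "\<lbrakk>s \<in> S; t \<in> S; group.ord W (s \<otimes>\<^bsub>W\<^esub> t) > 0; Poly_Mapping.keys v \<subseteq> X\<rbrakk> \<Longrightarrow>
      foldr op (alternating (group.ord W (s \<otimes>\<^bsub>W\<^esub> t)) s t) v
        = foldr op (alternating (group.ord W (s \<otimes>\<^bsub>W\<^esub> t)) t s) v"
begin

sublocale free: T_linear "\<lambda>f. free_act op f v" for v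
  unfolding free_act_def by (rule T_linear_T_extend)

lemma linear_foldr: "T_linear (foldr op w)"
  by (rule T_linear_foldr) (rule linear)

lemma free_act_add_right: "free_act op f (u + v) = free_act op f u + free_act op f v"
proof (induction f rule: poly_mapping_induct)
  case (single w c)
  show ?case by (simp add: T_linear.add[OF linear_foldr] T_scale_add)
qed (simp_all add: free.zero free.add)

lemma free_act_scale_right: "free_act op f (T_scale c v) = T_scale c (free_act op f v)"
proof (induction f rule: poly_mapping_induct)
  case (single w d)
  show ?case by (simp add: T_linear.scale[OF linear_foldr] mult.commute)
qed (simp_all add: free.zero free.add T_scale_add)

lemma free_act_zero_right: "free_act op f 0 = 0"
  using free_act_scale_right[of f 0 0] by simp

text \<open>Linearity in \<open>f\<close> and in \<open>g\<close> reduces this to words, where it is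
  composition.\<close>

lemma free_act_mult: "free_act op (f * g) v = free_act op f (free_act op g v)"
proof (induction f rule: poly_mapping_induct)
  case (single w c)
  show ?case
  proof (induction g rule: poly_mapping_induct)
    case (single w' c')
    show ?case by (simp add: mult_single plus_list_def T_linear.scale[OF linear_foldr] del: foldr_append)
        (simp add: foldr_append)
  next
    case (add f g)
    then show ?case
      by (simp add: distrib_left free.add T_linear.add[OF linear_foldr] T_scale_add)
  qed (simp add: free.zero T_linear.zero[OF linear_foldr])
qed (simp_all add: free.zero free.add distrib_right)

lemma foldr_closed:
  "set w \<subseteq> S \<Longrightarrow> Poly_Mapping.keys v \<subseteq> X \<Longrightarrow> Poly_Mapping.keys (foldr op w v) \<subseteq> X"
  by (induction w) (simp_all add: closed)

lemma free_act_closed: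
  assumes "Poly_Mapping.keys f \<subseteq> lists S" "Poly_Mapping.keys v \<subseteq> X"
  shows "Poly_Mapping.keys (free_act op f v) \<subseteq> X"
  unfolding free_act_def
proof (rule keys_T_extend)
  fix w assume "w \<in> Poly_Mapping.keys f"
  then show "Poly_Mapping.keys (foldr op w v) \<subseteq> X"
    using assms by (intro foldr_closed) auto
qed

definition annihilator :: "('w list \<Rightarrow>\<^sub>0 int poly) set" where
  "annihilator = {f. Poly_Mapping.keys f \<subseteq> lists S \<and>
    (\<forall>v. Poly_Mapping.keys v \<subseteq> X \<longrightarrow> free_act op f v = 0)}"

text \<open>For a product with the annihilating factor on the left, the other factor acts first; its
  values are again supported in \<open>X\<close>, hence annihilated.\<close>

lemma annihilator_ideal: "ideal annihilator (free_algebra S)"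
proof (rule idealI)
  interpret ring "free_algebra S" by (rule free_algebra_ring)
  have minus: "free_act op (- f) v = - free_act op f v" for f v
  proof -
    have "free_act op (0 - f) v = 0 - free_act op f v" by (simp only: free.diff free.zero)
    then show ?thesis by simp
  qed
  show "subgroup annihilator (add_monoid (free_algebra S))"
  proof (rule subgroup.intro)
    fix f g assume fg: "f \<in> annihilator" "g \<in> annihilator"
    then have "f \<oplus>\<^bsub>free_algebra S\<^esub> g \<in> carrier (free_algebra S)"
      by (intro a_closed) (simp_all add: annihilator_def)
    with fg show "f \<otimes>\<^bsub>add_monoid (free_algebra S)\<^esub> g \<in> annihilator"
      by (simp add: annihilator_def free.add)
  next
    fix f assume "f \<in> annihilator"
    then show "inv\<^bsub>add_monoid (free_algebra S)\<^esub> f \<in> annihilator"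
      unfolding a_inv_def[symmetric]
      by (auto simp: annihilator_def free_algebra_minus Poly_Mapping.keys_minus minus)
  qed (auto simp: annihilator_def free.zero)
  fix f g assume f: "f \<in> annihilator" and g: "g \<in> carrier (free_algebra S)"
  have "f \<in> carrier (free_algebra S)" using f by (simp add: annihilator_def)
  from m_closed[OF g this] m_closed[OF this g] f g show "g \<otimes>\<^bsub>free_algebra S\<^esub> f \<in> annihilator" "f \<otimes>\<^bsub>free_algebra S\<^esub> g \<in> annihilator"
    by (simp_all add: annihilator_def free_act_mult free_act_zero_right free_act_closed)
qed (rule free_algebra_ring)

lemma relations_subset_carrier:
  "braid_relations W S \<union> quadratic_relations S \<subseteq> carrier (free_algebra S)"
proof -
  interpret ring "free_algebra S" by (rule free_algebra_ring)
  have diff: "Poly_Mapping.keys (f - g) \<subseteq> lists S"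
    if "Poly_Mapping.keys f \<subseteq> lists S" "Poly_Mapping.keys g \<subseteq> lists S"
    for f g :: "'w list \<Rightarrow>\<^sub>0 int poly"
    using that Poly_Mapping.keys_diff[of f g] by blast
  have alt: "set (alternating m s t) \<subseteq> S" if "s \<in> S" "t \<in> S" for m s t
    using alternating_subset[of m s t] that by auto
  have "braid_relations W S \<subseteq> carrier (free_algebra S)"
  proof
    fix f assume "f \<in> braid_relations W S"
    then obtain m s t where st: "s \<in> S" "t \<in> S"
      and "f = Poly_Mapping.single (alternating m s t) 1 - Poly_Mapping.single (alternating m t s) 1"
      unfolding braid_relations_def prod_list_free_gen by blast
    moreover from this(3) have "Poly_Mapping.keys f \<subseteq> lists S"
      using alt[OF st] alt[OF st(2,1)] by (simp, intro diff) (simp_all add: in_lists_conv_set subset_iff)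
    ultimately show "f \<in> carrier (free_algebra S)" by simp
  qed
  moreover have "(free_gen s - free_scalar q_var) * (free_gen s + 1) \<in> carrier (free_algebra S)"
    if "s \<in> S" for s
  proof -
    have s: "free_gen s \<in> carrier (free_algebra S)" "free_scalar q_var \<in> carrier (free_algebra S)"
      using that by (simp_all add: free_gen_def free_scalar_def)
    then have "free_gen s - free_scalar q_var \<in> carrier (free_algebra S)"
      using diff by simp
    from m_closed[OF this a_closed[OF s(1) one_closed]] show ?thesis by simp
  qed
  ultimately show ?thesis by (auto simp: quadratic_relations_def)
qed

lemma hecke_ideal: "ideal (hecke_ideal W S) (free_algebra S)"
  unfolding hecke_ideal_def
  by (rule ring.genideal_ideal[OF free_algebra_ring relations_subset_carrier])

text \<open>The annihilator is an ideal, so it suffices that the generating relations act as zero.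
  This is what makes the action on cosets well defined.\<close>

lemma hecke_ideal_subset_annihilator: "hecke_ideal W S \<subseteq> annihilator"
  unfolding hecke_ideal_def
proof (rule ring.genideal_minimal[OF free_algebra_ring annihilator_ideal], rule subsetI)
  fix f assume f: "f \<in> braid_relations W S \<union> quadratic_relations S"
  have "free_act op f v = 0" if v: "Poly_Mapping.keys v \<subseteq> X" for v
    using f
  proof
    assume "f \<in> braid_relations W S"
    then show ?thesis
      by (auto simp: braid_relations_def prod_list_free_gen free.diff intro!: braid v)
  next
    assume "f \<in> quadratic_relations S"
    then obtain s where s: "s \<in> S" "f = (free_gen s - free_scalar q_var) * (free_gen s + 1)"
      by (auto simp: quadratic_relations_def)
    show ?thesis
      using quadratic[OF s(1) v]
      by (simp add: s(2) free_act_mult free.add free.diff T_linear.add[OF linear] T_scale_add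
          T_scale_diff_left)
  qed
  moreover have "f \<in> carrier (free_algebra S)"
    using f relations_subset_carrier by blast
  ultimately show "f \<in> annihilator"
    by (simp add: annihilator_def)
qed

text \<open>A coset acts through an arbitrarily chosen representative.\<close>

definition hecke_act :: "('w list \<Rightarrow>\<^sub>0 int poly) set \<Rightarrow> ('x \<Rightarrow>\<^sub>0 int poly) \<Rightarrow> ('x \<Rightarrow>\<^sub>0 int poly)" where
  "hecke_act c v = free_act op (SOME f. f \<in> c) v"

text \<open>The chosen representative differs from \<open>f\<close> by an element of the ideal,
  which acts as zero.\<close>

lemma hecke_act_coset:
  assumes f: "Poly_Mapping.keys f \<subseteq> lists S" and v: "Poly_Mapping.keys v \<subseteq> X"
  shows "hecke_act (hecke_ideal W S +>\<^bsub>free_algebra S\<^esub> f) v = free_act op f v"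
proof -
  interpret ideal "hecke_ideal W S" "free_algebra S" by (rule hecke_ideal)
  let ?c = "hecke_ideal W S +>\<^bsub>free_algebra S\<^esub> f"
  have "f \<in> ?c" using f by (intro a_rcos_self) simp
  then have "(SOME f. f \<in> ?c) \<in> ?c" by (rule someI)
  then obtain h where "h \<in> hecke_ideal W S" "(SOME f. f \<in> ?c) = h + f"
    by (auto simp: a_r_coset_def')
  moreover from this have "free_act op h v = 0"
    using hecke_ideal_subset_annihilator v by (auto simp: annihilator_def)
  ultimately show ?thesis by (simp add: hecke_act_def free.add)
qed

lemma hecke_module_structure: "hecke_module_structure W S (T_module X) hecke_act"
  unfolding hecke_module_structure_def
proof (intro conjI allI ballI)
  interpret ideal "hecke_ideal W S" "free_algebra S" by (rule hecke_ideal)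
  let ?cos = "\<lambda>f. hecke_ideal W S +>\<^bsub>free_algebra S\<^esub> f"
  \<comment> \<open>Every algebra element is the image of an element of the free algebra under this
    homomorphism, so each module axiom can be checked on representatives.\<close>
  have hom: "?cos \<in> ring_hom (free_algebra S) (hecke_algebra W S)"
    unfolding hecke_algebra_def by (rule rcos_ring_hom)
  have coset: "\<exists>f\<in>carrier (free_algebra S). a = ?cos f" if "a \<in> carrier (hecke_algebra W S)" for a
    using that by (auto simp: hecke_algebra_def FactRing_def A_RCOSETS_def')
  have closed: "f + g \<in> carrier (free_algebra S)" "f * g \<in> carrier (free_algebra S)"
    if "f \<in> carrier (free_algebra S)" "g \<in> carrier (free_algebra S)" for f g
    using a_closed[OF that] m_closed[OF that] by simp_all
  show "left_module (hecke_algebra W S) (with_action (T_module X) hecke_act)"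
  proof (intro left_module.intro left_module_axioms.intro)
    show "ring (hecke_algebra W S)"
      unfolding hecke_algebra_def by (rule quotient_is_ring)
    show "abelian_group (with_action (T_module X) hecke_act)"
      by (rule T_module_abelian_group)
  next
    fix a u assume "a \<in> carrier (hecke_algebra W S)"
      and u: "u \<in> carrier (with_action (T_module X) hecke_act)"
    then obtain f where f: "f \<in> carrier (free_algebra S)" "a = ?cos f"
      using coset by blast
    show "a \<odot>\<^bsub>with_action (T_module X) hecke_act\<^esub> u \<in> carrier (with_action (T_module X) hecke_act)"
      using f u by (simp add: hecke_act_coset free_act_closed)
    fix v assume v: "v \<in> carrier (with_action (T_module X) hecke_act)"
    have "Poly_Mapping.keys (u + v) \<subseteq> X" using u v Poly_Mapping.keys_add[of u v] by auto
    then show "a \<odot>\<^bsub>with_action (T_module X) hecke_act\<^esub> (u \<oplus>\<^bsub>with_action (T_module X) hecke_act\<^esub> v)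
      = a \<odot>\<^bsub>with_action (T_module X) hecke_act\<^esub> u \<oplus>\<^bsub>with_action (T_module X) hecke_act\<^esub>
        a \<odot>\<^bsub>with_action (T_module X) hecke_act\<^esub> v"
      using f u v by (simp add: hecke_act_coset free_act_add_right)
  next
    fix a b v assume "a \<in> carrier (hecke_algebra W S)" "b \<in> carrier (hecke_algebra W S)"
      and v: "v \<in> carrier (with_action (T_module X) hecke_act)"
    then obtain f g where fg: "f \<in> carrier (free_algebra S)" "g \<in> carrier (free_algebra S)"
      "a = ?cos f" "b = ?cos g"
      using coset by metis
    have sum: "a \<oplus>\<^bsub>hecke_algebra W S\<^esub> b = ?cos (f + g)"
      using ring_hom_add[OF hom fg(1,2)] fg(3,4) by simp
    have prod: "a \<otimes>\<^bsub>hecke_algebra W S\<^esub> b = ?cos (f * g)"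
      using ring_hom_mult[OF hom fg(1,2)] fg(3,4) by simp
    show "(a \<oplus>\<^bsub>hecke_algebra W S\<^esub> b) \<odot>\<^bsub>with_action (T_module X) hecke_act\<^esub> v
      = a \<odot>\<^bsub>with_action (T_module X) hecke_act\<^esub> v \<oplus>\<^bsub>with_action (T_module X) hecke_act\<^esub>
        b \<odot>\<^bsub>with_action (T_module X) hecke_act\<^esub> v"
      unfolding sum using fg v closed(1)[OF fg(1,2)] by (simp add: hecke_act_coset free.add)
    show "(a \<otimes>\<^bsub>hecke_algebra W S\<^esub> b) \<odot>\<^bsub>with_action (T_module X) hecke_act\<^esub> v
      = a \<odot>\<^bsub>with_action (T_module X) hecke_act\<^esub> (b \<odot>\<^bsub>with_action (T_module X) hecke_act\<^esub> v)"
      unfolding prod using fg v closed(2)[OF fg(1,2)]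
      by (simp add: hecke_act_coset free_act_mult free_act_closed)
  next
    fix v assume "v \<in> carrier (with_action (T_module X) hecke_act)"
    moreover have "\<one>\<^bsub>hecke_algebra W S\<^esub> = ?cos 1"
      using ring_hom_one[OF hom] by simp
    ultimately show "\<one>\<^bsub>hecke_algebra W S\<^esub> \<odot>\<^bsub>with_action (T_module X) hecke_act\<^esub> v = v"
      using one_closed by (simp add: hecke_act_coset)
  qed
next
  fix c v assume "v \<in> carrier (T_module X)"
  then show "hecke_act (hecke_scalar W S c) v = c \<odot>\<^bsub>T_module X\<^esub> v"
    by (simp add: hecke_scalar_def hecke_act_coset free_scalar_def)
qed

lemma hecke_act_gen:
  assumes "s \<in> S" "v \<in> carrier (T_module X)"
  shows "hecke_act (hecke_gen W S s) v = op s v"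
proof -
  have "Poly_Mapping.keys (free_gen s) \<subseteq> lists S" using assms(1) by (simp add: free_gen_def)
  then show ?thesis using assms(2) by (simp add: hecke_gen_def hecke_act_coset)
qed

end

theorem theorem7p1:
  fixes W :: "('w, 'b) monoid_scheme" and S :: "'w set"
    and X :: "'x set" and \<phi> :: "'w \<Rightarrow> 'x \<Rightarrow> 'x" and ht :: "'x \<Rightarrow> int"
  assumes "coxeter_system W S"
    and "quasiparabolic_W_set W S X \<phi> ht"
  shows "(\<forall>s \<in> S. \<forall>x \<in> X. ht (\<phi> s x) = ht x \<longrightarrow> \<phi> s x = x)
    \<and> (\<forall>\<epsilon> \<in> {\<epsilon>_plus, \<epsilon>_minus}.
        \<exists>act. hecke_module_structure W S (T_module X) act \<and>
          (\<forall>s \<in> S. \<forall>v \<in> carrier (T_module X). act (hecke_gen W S s) v = T_op \<phi> ht \<epsilon> s v))"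
proof (intro conjI ballI impI)
  interpret quasiparabolic_W_set W S X \<phi> ht by fact
  show "\<phi> s x = x" if "s \<in> S" "x \<in> X" "ht (\<phi> s x) = ht x" for s x
    using that by (rule fixed_if_ht_eq)
  fix \<epsilon> assume \<epsilon>: "\<epsilon> \<in> {\<epsilon>_plus, \<epsilon>_minus}"
  \<comment> \<open>For either sign the operators satisfy the defining relations on
    \<open>T(X)\<close>, which is what the general construction asks for.\<close>
  interpret hecke_operators W S X "T_op \<phi> ht \<epsilon>"
    by (rule hecke_operators.intro)
      (rule T_linear_T_op T_op_closed T_op_quadratic[OF \<epsilon>] T_op_braid[OF \<epsilon>]; assumption?)+
  show "\<exists>act. hecke_module_structure W S (T_module X) act \<and>
      (\<forall>s \<in> S. \<forall>v \<in> carrier (T_module X). act (hecke_gen W S s) v = T_op \<phi> ht \<epsilon> s v)"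
    using hecke_module_structure hecke_act_gen by blast
qed

end
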